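(* Let $K$ be a field of characteristic $0$. Then the algebra $F=K[C_1,C_2]$ (the generic algebra of $M_{11}(E)$ in two generators) and the algebra $A_1\subseteq UT_3(K)$ are PI equivalent, i.e. $T(F)=T(A_1)$.
   Context: All algebras are unitary associative algebras over $K$. $K\langle T\rangle$ is the free unitary associative algebra on $T=\{t_1,t_2,\dots\}$, and $T(A)\subseteq K\langle T\rangle$ is the ideal of all polynomial identities of an algebra $A$. Two algebras are PI equivalent if they satisfy the same polynomial identities. $UT_3(K)$ is the algebra of upper triangular $3\times 3$ matrices over $K$, and $A_1$ is its subalgebra consisting of all matrices whose $(1,1)$ and $(3,3)$ entries are equal. The algebra $F$: let $K[X;Y]=K[x_1,x_2,x_1',x_2']\otimes_K E(y_1,y_2,y_1',y_2')$ be the free supercommutative algebra on even (commuting, central) variables $X=\{x_1,x_2,x_1',x_2'\}$ and odd (pairwise anticommuting, square zero) variables $Y=\{y_1,y_2,y_1',y_2'\}$, where $E(y_1,y_2,y_1',y_2')$ is the Grassmann algebra on the vector space with basis $Y$. Put $C_i=\begin{pmatrix}x_i&y_i\\ y_i'&x_i'\end{pmatrix}\in M_2(K[X;Y])$ for $i=1,2$. Then $F=K[C_1,C_2]$ is the unitary $K$-subalgebra of $M_2(K[X;Y])$ generated by $C_1$ and $C_2$ (it is isomorphic to the relatively free algebra of rank 2 of $M_{11}(E)$, where $E$ is the infinite dimensional Grassmann algebra and $M_{11}(E)\subseteq M_2(E)$ consists of the matrices with diagonal entries in $E_0$ and off-diagonal entries in $E_1$). *)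

theory Defs
  imports "HOL-Analysis.Cartesian_Space" "HOL-Library.Poly_Mapping"
begin

section \<open>The free associative algebra\<close>

text \<open>Words under concatenation. They are wrapped in a type of their own, written additively,
  because the ring structure on finitely supported functions \<open>'m \<Rightarrow>\<^sub>0 'k\<close> expects the monoid
  \<open>'m\<close> in class \<^class>\<open>monoid_add\<close>; the addition is not commutative.\<close>

typedef 'v mon = "UNIV :: 'v list set"
  morphisms letters mon_of by simp

setup_lifting type_definition_mon

instantiation mon :: (type) monoid_add
begin
lift_definition zero_mon :: "'v mon" is "[]" .
lift_definition plus_mon :: "'v mon \<Rightarrow> 'v mon \<Rightarrow> 'v mon" is "(@)" .
instance by standard (transfer, simp)+
end

text \<open>The variable of index \<open>v\<close> is \<open>Poly_Mapping.single (mon_of [v]) 1\<close>. For \<open>K\<langle>t\<^sub>1, t\<^sub>2, \<dots>\<rangle>\<close> the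
  index type is \<^typ>\<open>nat\<close>, so that \<open>t\<^sub>i\<close> has index \<open>i - 1\<close>.\<close>

type_synonym ('v, 'k) free_algebra = "'v mon \<Rightarrow>\<^sub>0 'k"


section \<open>Algebras, subalgebras, polynomial identities\<close>

locale assoc_algebra = module smul
  for smul :: "'k::comm_ring_1 \<Rightarrow> 'a::ring_1 \<Rightarrow> 'a" +
  assumes smul_mult_left: "smul c (a * b) = smul c a * b"
    and smul_mult_right: "smul c (a * b) = a * smul c b"

definition is_subalgebra :: "('k \<Rightarrow> 'a::ring_1 \<Rightarrow> 'a) \<Rightarrow> 'a set \<Rightarrow> bool" where
  "is_subalgebra smul B \<longleftrightarrow>
     1 \<in> B \<and> (\<forall>a\<in>B. \<forall>b\<in>B. a + b \<in> B \<and> a * b \<in> B) \<and> (\<forall>c. \<forall>a\<in>B. smul c a \<in> B)"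

definition generated_subalgebra :: "('k \<Rightarrow> 'a::ring_1 \<Rightarrow> 'a) \<Rightarrow> 'a set \<Rightarrow> 'a set" where
  "generated_subalgebra smul S = is_subalgebra smul hull S"

definition eval_poly ::
    "('k::zero \<Rightarrow> 'a::ring_1 \<Rightarrow> 'a) \<Rightarrow> ('v \<Rightarrow> 'a) \<Rightarrow> ('v, 'k) free_algebra \<Rightarrow> 'a" where
  "eval_poly smul \<sigma> f =
     (\<Sum>w\<in>Poly_Mapping.keys f. smul (Poly_Mapping.lookup f w) (prod_list (map \<sigma> (letters w))))"

definition T_ideal ::
    "('k::zero \<Rightarrow> 'a::ring_1 \<Rightarrow> 'a) \<Rightarrow> 'a set \<Rightarrow> (nat, 'k) free_algebra set" where
  "T_ideal smul A = {f. \<forall>\<sigma>. range \<sigma> \<subseteq> A \<longrightarrow> eval_poly smul \<sigma> f = 0}"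

definition PI_equivalent ::
    "('k::zero \<Rightarrow> 'a::ring_1 \<Rightarrow> 'a) \<Rightarrow> 'a set \<Rightarrow> ('k \<Rightarrow> 'b::ring_1 \<Rightarrow> 'b) \<Rightarrow> 'b set \<Rightarrow> bool" where
  "PI_equivalent smulA A smulB B \<longleftrightarrow> T_ideal smulA A = T_ideal smulB B"

lemma is_subalgebra_generated: "is_subalgebra smul (generated_subalgebra smul S)"
  unfolding generated_subalgebra_def by (rule hull_in) (auto simp: is_subalgebra_def)

lemma poly_mapping_single_induct [case_names zero single_add]:
  fixes f :: "'a \<Rightarrow>\<^sub>0 'b::monoid_add"
  assumes "P 0" "\<And>f w c. P f \<Longrightarrow> P (Poly_Mapping.single w c + f)"
  shows "P f"
proof (induction f rule: update_induct)
  case (update f a b)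
  then have "Poly_Mapping.update a b f = Poly_Mapping.single a b + f"
    by (intro poly_mapping_eqI)
      (auto simp: lookup_update lookup_add lookup_single when_def in_keys_iff)
  then show ?case using update assms(2) by simp
qed (fact assms(1))

context assoc_algebra
begin

lemma eval_poly_superset:
  assumes "finite S" "Poly_Mapping.keys f \<subseteq> S"
  shows "eval_poly smul \<sigma> f =
    (\<Sum>w\<in>S. smul (Poly_Mapping.lookup f w) (prod_list (map \<sigma> (letters w))))"
  unfolding eval_poly_def
  by (rule sum.mono_neutral_left) (use assms in \<open>auto simp: in_keys_iff\<close>)

lemma eval_poly_single:
  "eval_poly smul \<sigma> (Poly_Mapping.single w c) = smul c (prod_list (map \<sigma> (letters w)))"
  by (subst eval_poly_superset[where S="{w}"]) auto

lemma eval_poly_add: "eval_poly smul \<sigma> (f + g) = eval_poly smul \<sigma> f + eval_poly smul \<sigma> g"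
proof -
  let ?S = "Poly_Mapping.keys f \<union> Poly_Mapping.keys g"
  have "Poly_Mapping.keys (f + g) \<subseteq> ?S" by (rule keys_add)
  then show ?thesis
    by (simp add: eval_poly_superset[where S="?S"] lookup_add scale_left_distrib sum.distrib)
qed

lemma eval_poly_zero: "eval_poly smul \<sigma> 0 = 0"
  by (simp add: eval_poly_def)

lemma eval_poly_one: "eval_poly smul \<sigma> 1 = 1"
  using eval_poly_single[of \<sigma> 0 1] by (simp add: zero_mon.rep_eq)

lemma eval_poly_mult: "eval_poly smul \<sigma> (f * g) = eval_poly smul \<sigma> f * eval_poly smul \<sigma> g"
proof -
  have single_single: "eval_poly smul \<sigma> (Poly_Mapping.single w c * Poly_Mapping.single w' c') =
      eval_poly smul \<sigma> (Poly_Mapping.single w c) * eval_poly smul \<sigma> (Poly_Mapping.single w' c')"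
    for w w' c c'
    by (simp add: mult_single eval_poly_single plus_mon.rep_eq mult.commute
        flip: smul_mult_left smul_mult_right)
  have single_left: "eval_poly smul \<sigma> (Poly_Mapping.single w c * g) =
      eval_poly smul \<sigma> (Poly_Mapping.single w c) * eval_poly smul \<sigma> g" for w c
    by (induction g rule: poly_mapping_single_induct)
      (simp_all add: single_single eval_poly_zero eval_poly_add distrib_left)
  show ?thesis
    by (induction f rule: poly_mapping_single_induct)
      (simp_all add: single_left eval_poly_zero eval_poly_add distrib_right)
qed

end


section \<open>Grassmann algebras\<close>

text \<open>The Grassmann algebra over a commutative ring \<open>'r\<close> on generators indexed by the finite
  linearly ordered type \<open>'i\<close>. It is free as an \<open>'r\<close>-module on the products
  \<open>y\<^sub>A = y\<^sub>a\<^sub>1 \<cdots> y\<^sub>a\<^sub>m\<close> for \<open>A = {a\<^sub>1 < \<cdots> < a\<^sub>m}\<close>; an element is given by its coefficient function.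
  For disjoint \<open>A\<close>, \<open>B\<close> one has \<open>y\<^sub>A y\<^sub>B = (-1)\<^sup>n y\<^sub>A\<^sub>\<union>\<^sub>B\<close>, where \<open>n\<close> is the number of inversions
  between \<open>A\<close> and \<open>B\<close>; otherwise the product is zero.\<close>

typedef ('i, 'r) grassmann = "UNIV :: ('i set \<Rightarrow> 'r) set"
  morphisms gr_coeff Grassmann by simp

setup_lifting type_definition_grassmann

definition shuffle_sign :: "'i::linorder set \<Rightarrow> 'i set \<Rightarrow> 'r::comm_ring_1" where
  "shuffle_sign A B = (- 1) ^ card {(a, b). a \<in> A \<and> b \<in> B \<and> b < a}"

lemma shuffle_sign_empty [simp]: "shuffle_sign {} B = 1" "shuffle_sign A {} = 1"
  by (simp_all add: shuffle_sign_def)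

lemma shuffle_sign_Un_left:
  fixes A B C :: "'i::{finite,linorder} set"
  assumes "A \<inter> B = {}"
  shows "shuffle_sign (A \<union> B) C = shuffle_sign A C * shuffle_sign B C"
proof -
  have "{(a, b). a \<in> A \<union> B \<and> b \<in> C \<and> b < a} =
      {(a, b). a \<in> A \<and> b \<in> C \<and> b < a} \<union> {(a, b). a \<in> B \<and> b \<in> C \<and> b < a}" by auto
  moreover have "{(a, b). a \<in> A \<and> b \<in> C \<and> b < a} \<inter> {(a, b). a \<in> B \<and> b \<in> C \<and> b < a} = {}"
    using assms by auto
  ultimately show ?thesis
    by (simp add: shuffle_sign_def card_Un_disjoint power_add)
qed

lemma shuffle_sign_Un_right:
  fixes A B C :: "'i::{finite,linorder} set"
  assumes "B \<inter> C = {}"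
  shows "shuffle_sign A (B \<union> C) = shuffle_sign A B * shuffle_sign A C"
proof -
  have "{(a, b). a \<in> A \<and> b \<in> B \<union> C \<and> b < a} =
      {(a, b). a \<in> A \<and> b \<in> B \<and> b < a} \<union> {(a, b). a \<in> A \<and> b \<in> C \<and> b < a}" by auto
  moreover have "{(a, b). a \<in> A \<and> b \<in> B \<and> b < a} \<inter> {(a, b). a \<in> A \<and> b \<in> C \<and> b < a} = {}"
    using assms by auto
  ultimately show ?thesis
    by (simp add: shuffle_sign_def card_Un_disjoint power_add)
qed

instantiation grassmann :: (type, comm_ring_1) ab_group_add
begin
lift_definition zero_grassmann :: "('i, 'r::comm_ring_1) grassmann" is "\<lambda>S. 0" .
lift_definition plus_grassmann ::
  "('i, 'r::comm_ring_1) grassmann \<Rightarrow> ('i, 'r) grassmann \<Rightarrow> ('i, 'r) grassmann"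
  is "\<lambda>f g S. f S + g S" .
lift_definition minus_grassmann ::
  "('i, 'r::comm_ring_1) grassmann \<Rightarrow> ('i, 'r) grassmann \<Rightarrow> ('i, 'r) grassmann"
  is "\<lambda>f g S. f S - g S" .
lift_definition uminus_grassmann ::
  "('i, 'r::comm_ring_1) grassmann \<Rightarrow> ('i, 'r) grassmann"
  is "\<lambda>f S. - f S" .
instance by standard (transfer; simp add: fun_eq_iff algebra_simps)+
end

lemma triple_sum_Pow:
  fixes h :: "'i::finite set \<Rightarrow> 'i set \<Rightarrow> 'i set \<Rightarrow> 'r::comm_ring_1"
  shows "(\<Sum>A\<in>Pow S. \<Sum>B\<in>Pow A. h B (A - B) (S - A)) =
         (\<Sum>B\<in>Pow S. \<Sum>C\<in>Pow (S - B). h B C (S - B - C))"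
proof -
  have "(\<Sum>A\<in>Pow S. \<Sum>B\<in>Pow A. h B (A - B) (S - A)) =
      (\<Sum>(A, B)\<in>Sigma (Pow S) Pow. h B (A - B) (S - A))"
    by (simp add: sum.Sigma)
  also have "\<dots> = (\<Sum>(B, C)\<in>Sigma (Pow S) (\<lambda>B. Pow (S - B)). h B C (S - B - C))"
    by (rule sum.reindex_bij_witness[where i="\<lambda>(B, C). (B \<union> C, B)" and j="\<lambda>(A, B). (B, A - B)"])
      (auto intro!: arg_cong2[where f="h _"] arg_cong[where f="h _ _"])
  finally show ?thesis by (simp add: sum.Sigma)
qed

instantiation grassmann :: ("{finite,linorder}", comm_ring_1) ring_1
begin
lift_definition one_grassmann :: "('i::{finite,linorder}, 'r::comm_ring_1) grassmann"
  is "\<lambda>S. if S = {} then 1 else 0" .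
lift_definition times_grassmann ::
  "('i::{finite,linorder}, 'r::comm_ring_1) grassmann \<Rightarrow> ('i, 'r) grassmann \<Rightarrow> ('i, 'r) grassmann"
  is "\<lambda>f g S. \<Sum>A\<in>Pow S. shuffle_sign A (S - A) * f A * g (S - A)" .
instance
proof
  fix a b c :: "('i::{finite,linorder}, 'r::comm_ring_1) grassmann"
  show "a * b * c = a * (b * c)"
  proof (transfer, rule ext)
    fix f g h :: "'i set \<Rightarrow> 'r" and S :: "'i set"
    let ?t = "\<lambda>B C D. shuffle_sign (B \<union> C) D * shuffle_sign B C * f B * g C * h D"
    have "(\<Sum>A\<in>Pow S. shuffle_sign A (S - A) *
          (\<Sum>B\<in>Pow A. shuffle_sign B (A - B) * f B * g (A - B)) * h (S - A)) =
        (\<Sum>A\<in>Pow S. \<Sum>B\<in>Pow A. ?t B (A - B) (S - A))"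
      unfolding sum_distrib_left sum_distrib_right
      by (intro sum.cong refl) (auto simp: Un_absorb1 mult_ac)
    also have "\<dots> = (\<Sum>B\<in>Pow S. \<Sum>C\<in>Pow (S - B). ?t B C (S - B - C))"
      by (rule triple_sum_Pow)
    also have "\<dots> = (\<Sum>B\<in>Pow S. shuffle_sign B (S - B) * f B *
          (\<Sum>C\<in>Pow (S - B). shuffle_sign C (S - B - C) * g C * h (S - B - C)))"
      unfolding sum_distrib_left sum_distrib_right
    proof (intro sum.cong refl)
      fix B C assume "B \<in> Pow S" and C: "C \<in> Pow (S - B)"
      have "shuffle_sign (B \<union> C) (S - B - C) =
          (shuffle_sign B (S - B - C) * shuffle_sign C (S - B - C) :: 'r)"
        using C by (intro shuffle_sign_Un_left) auto
      moreover have "shuffle_sign B (S - B) = (shuffle_sign B C * shuffle_sign B (S - B - C) :: 'r)"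
        using C by (subst shuffle_sign_Un_right[symmetric]) (auto intro!: arg_cong2[where f=shuffle_sign])
      ultimately show "?t B C (S - B - C) = shuffle_sign B (S - B) * f B *
          (shuffle_sign C (S - B - C) * g C * h (S - B - C))"
        by (simp add: mult_ac)
    qed
    finally show "(\<Sum>A\<in>Pow S. shuffle_sign A (S - A) *
          (\<Sum>B\<in>Pow A. shuffle_sign B (A - B) * f B * g (A - B)) * h (S - A)) =
        (\<Sum>B\<in>Pow S. shuffle_sign B (S - B) * f B *
          (\<Sum>C\<in>Pow (S - B). shuffle_sign C (S - B - C) * g C * h (S - B - C)))" .
  qed
  show "1 * a = a"
  proof (transfer, rule ext)
    fix f :: "'i set \<Rightarrow> 'r" and S :: "'i set"
    have "(\<Sum>A\<in>Pow S. shuffle_sign A (S - A) * (if A = {} then 1 else 0) * f (S - A)) =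
        (\<Sum>A\<in>Pow S. if A = {} then f S else 0)"
      by (rule sum.cong) auto
    then show "(\<Sum>A\<in>Pow S. shuffle_sign A (S - A) * (if A = {} then 1 else 0) * f (S - A)) = f S"
      by (simp add: sum.delta)
  qed
  show "a * 1 = a"
  proof (transfer, rule ext)
    fix f :: "'i set \<Rightarrow> 'r" and S :: "'i set"
    have "(\<Sum>A\<in>Pow S. shuffle_sign A (S - A) * f A * (if S - A = {} then 1 else 0)) =
        (\<Sum>A\<in>Pow S. if A = S then f S else 0)"
      by (rule sum.cong) auto
    then show "(\<Sum>A\<in>Pow S. shuffle_sign A (S - A) * f A * (if S - A = {} then 1 else 0)) = f S"
      by (simp add: sum.delta)
  qed
  show "(a + b) * c = a * c + b * c"
    by transfer (simp add: fun_eq_iff algebra_simps sum.distrib)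
  show "a * (b + c) = a * b + a * c"
    by transfer (simp add: fun_eq_iff algebra_simps sum.distrib)
  show "(0 :: ('i, 'r) grassmann) \<noteq> 1"
    by transfer (auto simp: fun_eq_iff)
qed
end

lift_definition gr_scalar :: "'r::comm_ring_1 \<Rightarrow> ('i, 'r) grassmann"
  is "\<lambda>r S. if S = {} then r else 0" .

lift_definition gr_gen :: "'i \<Rightarrow> ('i, 'r::comm_ring_1) grassmann"
  is "\<lambda>i S. if S = {i} then 1 else 0" .

lemma gr_scalar_mult:
  fixes a :: "('i::{finite,linorder}, 'r::comm_ring_1) grassmann"
  shows "gr_coeff (gr_scalar r * a) S = r * gr_coeff a S"
proof transfer
  fix r :: 'r and f :: "'i set \<Rightarrow> 'r" and S
  have "(\<Sum>A\<in>Pow S. shuffle_sign A (S - A) * (if A = {} then r else 0) * f (S - A)) =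
      (\<Sum>A\<in>Pow S. if A = {} then r * f S else 0)"
    by (rule sum.cong) auto
  then show "(\<Sum>A\<in>Pow S. shuffle_sign A (S - A) * (if A = {} then r else 0) * f (S - A)) = r * f S"
    by (simp add: sum.delta)
qed

lemma gr_scalar_central:
  fixes a :: "('i::{finite,linorder}, 'r::comm_ring_1) grassmann"
  shows "gr_scalar r * a = a * gr_scalar r"
proof transfer
  fix r :: 'r and f :: "'i set \<Rightarrow> 'r"
  show "(\<lambda>S. \<Sum>A\<in>Pow S. shuffle_sign A (S - A) * (if A = {} then r else 0) * f (S - A)) =
      (\<lambda>S. \<Sum>A\<in>Pow S. shuffle_sign A (S - A) * f A * (if S - A = {} then r else 0))"
  proof
    fix S
    have "(\<Sum>A\<in>Pow S. shuffle_sign A (S - A) * (if A = {} then r else 0) * f (S - A)) =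
        (\<Sum>A\<in>Pow S. if A = {} then r * f S else 0)"
      by (rule sum.cong) auto
    moreover have "(\<Sum>A\<in>Pow S. shuffle_sign A (S - A) * f A * (if S - A = {} then r else 0)) =
        (\<Sum>A\<in>Pow S. if A = S then r * f S else 0)"
      by (rule sum.cong) auto
    ultimately show "(\<Sum>A\<in>Pow S. shuffle_sign A (S - A) * (if A = {} then r else 0) * f (S - A)) =
        (\<Sum>A\<in>Pow S. shuffle_sign A (S - A) * f A * (if S - A = {} then r else 0))"
      by (simp add: sum.delta)
  qed
qed

lemma gr_coeff_gen_mult_gen:
  "gr_coeff (gr_gen i * gr_gen j :: ('i::{finite,linorder}, 'r::comm_ring_1) grassmann) S =
     (if i \<noteq> j \<and> S = {i, j} then (if i < j then 1 else - 1) else 0)"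
proof -
  have "gr_coeff (gr_gen i * gr_gen j :: ('i, 'r) grassmann) S =
      (\<Sum>A\<in>Pow S. if A = {i} then shuffle_sign {i} (S - {i}) * (if S - {i} = {j} then 1 else 0) else 0)"
    unfolding times_grassmann.rep_eq gr_gen.rep_eq by (rule sum.cong) auto
  also have "\<dots> = (if i \<in> S \<and> S - {i} = {j} then shuffle_sign {i} {j} else 0)"
    by (simp add: sum.delta)
  also have "i \<in> S \<and> S - {i} = {j} \<longleftrightarrow> i \<noteq> j \<and> S = {i, j}" by auto
  finally show ?thesis
  proof (rule trans, intro if_cong refl)
    assume "i \<noteq> j \<and> S = {i, j}"
    then have *: "i < j \<or> j < i" by auto
    have "{(a, b). a \<in> {i} \<and> b \<in> {j} \<and> b < a} = (if j < i then {(i, j)} else {})" by auto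
    then show "shuffle_sign {i} {j} = (if i < j then 1 else - 1 :: 'r)"
      using * by (auto simp: shuffle_sign_def)
  qed
qed

lemma gr_gen_anticommute: "gr_gen i * gr_gen j = - (gr_gen j * gr_gen i)"
  unfolding gr_coeff_inject[symmetric] fun_eq_iff uminus_grassmann.rep_eq gr_coeff_gen_mult_gen
  by auto

lemma gr_gen_square: "gr_gen i * gr_gen i = 0"
  unfolding gr_coeff_inject[symmetric] fun_eq_iff zero_grassmann.rep_eq gr_coeff_gen_mult_gen
  by simp


section \<open>Square matrices as a ring\<close>

text \<open>The multiplication that the library provides on \<open>'a^'n^'n\<close> as an instance of \<^class>\<open>times\<close> is
  componentwise, hence a type of its own.\<close>

typedef ('a, 'n) sqmat = "UNIV :: ('a^'n^'n) set"
  morphisms entries sqmat_of by simp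

setup_lifting type_definition_sqmat

instantiation sqmat :: (ring_1, finite) ring_1
begin
lift_definition zero_sqmat :: "('a::ring_1, 'n::finite) sqmat" is 0 .
lift_definition one_sqmat :: "('a::ring_1, 'n::finite) sqmat" is "mat 1" .
lift_definition plus_sqmat ::
  "('a::ring_1, 'n::finite) sqmat \<Rightarrow> ('a, 'n) sqmat \<Rightarrow> ('a, 'n) sqmat" is "(+)" .
lift_definition minus_sqmat ::
  "('a::ring_1, 'n::finite) sqmat \<Rightarrow> ('a, 'n) sqmat \<Rightarrow> ('a, 'n) sqmat" is "(-)" .
lift_definition uminus_sqmat ::
  "('a::ring_1, 'n::finite) sqmat \<Rightarrow> ('a, 'n) sqmat" is uminus .
lift_definition times_sqmat ::
  "('a::ring_1, 'n::finite) sqmat \<Rightarrow> ('a, 'n) sqmat \<Rightarrow> ('a, 'n) sqmat" is "(**)" .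
instance
proof
  fix a b c :: "('a::ring_1, 'n::finite) sqmat"
  show "a * b * c = a * (b * c)" by transfer (simp add: matrix_mul_assoc)
  show "(a + b) * c = a * c + b * c"
    by transfer (simp add: matrix_matrix_mult_def vec_eq_iff distrib_right sum.distrib)
  show "a * (b + c) = a * b + a * c" by transfer (rule matrix_add_ldistrib)
  show "(0 :: ('a, 'n) sqmat) \<noteq> 1" by transfer (auto simp: mat_def vec_eq_iff)
qed (transfer; simp)+
end

lift_definition sqmat_scale ::
    "('k \<Rightarrow> 'a \<Rightarrow> 'a) \<Rightarrow> 'k \<Rightarrow> ('a, 'n::finite) sqmat \<Rightarrow> ('a, 'n) sqmat"
  is "\<lambda>smul c M. \<chi> i j. smul c (M $ i $ j)" .

lemma assoc_algebra_sqmat: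
  assumes "assoc_algebra (smul :: 'k::comm_ring_1 \<Rightarrow> 'a::ring_1 \<Rightarrow> 'a)"
  shows "assoc_algebra
    (sqmat_scale smul :: 'k \<Rightarrow> ('a, 'n::finite) sqmat \<Rightarrow> ('a, 'n) sqmat)"
proof -
  interpret assoc_algebra smul by (fact assms)
  show ?thesis
  proof
    fix c d :: 'k and x y :: "('a, 'n) sqmat"
    show "sqmat_scale smul c (x + y) = sqmat_scale smul c x + sqmat_scale smul c y"
      by (transfer fixing: smul) (simp add: vec_eq_iff scale_right_distrib)
    show "sqmat_scale smul (c + d) x = sqmat_scale smul c x + sqmat_scale smul d x"
      by (transfer fixing: smul) (simp add: vec_eq_iff scale_left_distrib)
    show "sqmat_scale smul c (sqmat_scale smul d x) = sqmat_scale smul (c * d) x"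
      by (transfer fixing: smul) (simp add: vec_eq_iff)
    show "sqmat_scale smul 1 x = x"
      by (transfer fixing: smul) (simp add: vec_eq_iff)
    show "sqmat_scale smul c (x * y) = sqmat_scale smul c x * y"
      by (transfer fixing: smul) (simp add: vec_eq_iff matrix_matrix_mult_def scale_sum_right smul_mult_left)
    show "sqmat_scale smul c (x * y) = x * sqmat_scale smul c y"
      by (transfer fixing: smul) (simp add: vec_eq_iff matrix_matrix_mult_def scale_sum_right smul_mult_right)
  qed
qed


section \<open>The generic algebra in two generators\<close>

text \<open>One index type for both families of variables: the even ones \<open>x\<^sub>1, x\<^sub>2, x\<^sub>1', x\<^sub>2'\<close> and the odd
  ones \<open>y\<^sub>1, y\<^sub>2, y\<^sub>1', y\<^sub>2'\<close>. Its linear order only fixes the order of the factors in the basis of the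
  Grassmann algebra.\<close>

datatype gvar = V1 | V2 | V1' | V2'

fun gvar_rank :: "gvar \<Rightarrow> nat" where
  "gvar_rank V1 = 0" | "gvar_rank V2 = 1" | "gvar_rank V1' = 2" | "gvar_rank V2' = 3"

lemma UNIV_gvar: "UNIV = {V1, V2, V1', V2'}"
  using gvar.exhaust by blast

lemma gvar_rank_eq_iff [simp]: "gvar_rank v = gvar_rank w \<longleftrightarrow> v = w"
  by (cases v; cases w) auto

instance gvar :: finite
  by standard (simp add: UNIV_gvar)

instantiation gvar :: linorder
begin
definition less_eq_gvar :: "gvar \<Rightarrow> gvar \<Rightarrow> bool" where "v \<le> w \<longleftrightarrow> gvar_rank v \<le> gvar_rank w"
definition less_gvar :: "gvar \<Rightarrow> gvar \<Rightarrow> bool" where "v < w \<longleftrightarrow> gvar_rank v < gvar_rank w"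
instance by standard (auto simp: less_eq_gvar_def less_gvar_def simp flip: gvar_rank_eq_iff)
end

text \<open>\<open>K[X;Y]\<close> is the Grassmann algebra on \<open>Y\<close> over the polynomial ring
  \<open>K[X] = (gvar \<Rightarrow>\<^sub>0 nat) \<Rightarrow>\<^sub>0 K\<close>, which is the same as \<open>K[X] \<otimes>\<^sub>K E(Y)\<close>.\<close>

type_synonym 'k supercomm = "(gvar, (gvar \<Rightarrow>\<^sub>0 nat) \<Rightarrow>\<^sub>0 'k) grassmann"

definition sc_scale :: "'k::comm_ring_1 \<Rightarrow> 'k supercomm \<Rightarrow> 'k supercomm" where
  "sc_scale c a = gr_scalar (Poly_Mapping.single 0 c) * a"

definition even_var :: "gvar \<Rightarrow> 'k::comm_ring_1 supercomm" where
  "even_var v = gr_scalar (Poly_Mapping.single (Poly_Mapping.single v 1) 1)"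

definition odd_var :: "gvar \<Rightarrow> 'k::comm_ring_1 supercomm" where
  "odd_var v = gr_gen v"

lemma assoc_algebra_supercomm: "assoc_algebra (sc_scale :: 'k::comm_ring_1 \<Rightarrow> _)"
proof
  fix a b :: 'k and x y :: "'k supercomm"
  show "sc_scale a (x + y) = sc_scale a x + sc_scale a y"
    by (simp add: sc_scale_def distrib_left)
  show "sc_scale (a + b) x = sc_scale a x + sc_scale b x"
    unfolding sc_scale_def gr_coeff_inject[symmetric] fun_eq_iff plus_grassmann.rep_eq gr_scalar_mult
    by (simp add: single_add distrib_right)
  show "sc_scale a (sc_scale b x) = sc_scale (a * b) x"
    unfolding sc_scale_def gr_coeff_inject[symmetric] fun_eq_iff gr_scalar_mult
    by (simp add: mult_single flip: mult.assoc)
  show "sc_scale 1 x = x"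
    unfolding sc_scale_def gr_coeff_inject[symmetric] fun_eq_iff gr_scalar_mult
    by simp
  show "sc_scale a (x * y) = sc_scale a x * y"
    by (simp add: sc_scale_def mult.assoc)
  show "sc_scale a (x * y) = x * sc_scale a y"
    unfolding sc_scale_def by (metis gr_scalar_central mult.assoc)
qed

definition generic_matrix :: "gvar \<Rightarrow> gvar \<Rightarrow> ('k::comm_ring_1 supercomm, 2) sqmat" where
  "generic_matrix v v' =
     sqmat_of (vector [vector [even_var v,  odd_var v],
                       vector [odd_var v', even_var v']])"

lemma generic_matrix_entries:
  "entries (generic_matrix v v') $ 1 $ 1 = even_var v"
  "entries (generic_matrix v v') $ 1 $ 2 = odd_var v"
  "entries (generic_matrix v v') $ 2 $ 1 = odd_var v'"
  "entries (generic_matrix v v') $ 2 $ 2 = even_var v'"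
  by (simp_all add: generic_matrix_def sqmat_of_inverse)

definition C1 :: "('k::comm_ring_1 supercomm, 2) sqmat" where "C1 = generic_matrix V1 V1'"
definition C2 :: "('k::comm_ring_1 supercomm, 2) sqmat" where "C2 = generic_matrix V2 V2'"

definition F :: "('k::comm_ring_1 supercomm, 2) sqmat set" where
  "F = generated_subalgebra (sqmat_scale sc_scale) {C1, C2}"


section \<open>The algebra of upper triangular matrices and its subalgebra\<close>

text \<open>In the index type \<open>3\<close> one has \<open>3 = 0\<close>, so its order is not that of the row numbers and the
  entries below the diagonal are listed explicitly.\<close>

definition UT3 :: "('k::comm_ring_1, 3) sqmat set" where
  "UT3 = {M. entries M $ 2 $ 1 = 0 \<and> entries M $ 3 $ 1 = 0 \<and> entries M $ 3 $ 2 = 0}"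

definition A1 :: "('k::comm_ring_1, 3) sqmat set" where
  "A1 = {M \<in> UT3. entries M $ 1 $ 1 = entries M $ 3 $ 3}"

lemma assoc_algebra_base: "assoc_algebra ((*) :: 'k::comm_ring_1 \<Rightarrow> 'k \<Rightarrow> 'k)"
  by unfold_locales (simp_all add: algebra_simps)

lemma is_subalgebra_A1: "is_subalgebra (sqmat_scale (*)) (A1 :: ('k::comm_ring_1, 3) sqmat set)"
  by (auto simp: is_subalgebra_def A1_def UT3_def one_sqmat.rep_eq plus_sqmat.rep_eq
      times_sqmat.rep_eq sqmat_scale.rep_eq mat_def matrix_matrix_mult_def sum_3)

end

(* Since x_1 - x_1' is generically invertible, an odd conjugation diagonalises C_1 and turns the
   off-diagonal entries of C_2 into central multiples of two odd elements eta and theta with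
   eta^2 = theta^2 = 0. The elements of F then have the form
     ((a + c eta theta, b eta), (e theta, d + g theta eta))
   with central coefficients, and multiplying such matrices amounts to multiplying the pairs
     ((a, b, c), (0, d, e), (0, 0, a)),  ((d, e, g), (0, a, b), (0, 0, d))
   of matrices of the shape of A_1. As K is infinite, an identity of A_1 holds for all matrices of
   this shape with central entries, hence it holds in F.
   Conversely, put x_1 = 1, x_2 = x_1' = x_2' = 0 and y_1 = y_1' = 0. Then C_1 and C_2 generate all
   matrices of the first form with a, b, c, d, e in K and g = 0, eta = y_2, theta = y_2', so that
   identities of F hold in A_1. *)
theory Submission
  imports Defs "HOL-Computational_Algebra.Polynomial"
begin

section \<open>Coefficients of vanishing polynomials\<close>

text \<open>A nonzero univariate polynomial over a domain has only finitely many roots. Exponents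
  may coincide, so a coefficient is the sum of all \<open>c i\<close> with the same
  exponent.\<close>

lemma power_sum_coeffs_zero:
  fixes c :: "'i \<Rightarrow> 'k::idom"
  assumes "finite I" "infinite T" "\<And>t. t \<in> T \<Longrightarrow> (\<Sum>i\<in>I. c i * t ^ e i) = 0"
  shows "(\<Sum>i\<in>{i\<in>I. e i = k}. c i) = 0"
proof -
  define p where "p = (\<Sum>i\<in>I. monom (c i) (e i))"
  have "T \<subseteq> {t. poly p t = 0}"
    using assms(3) by (auto simp: p_def poly_sum poly_monom)
  then have "p = 0"
    using \<open>infinite T\<close> poly_roots_finite[of p] finite_subset by blast
  then have "0 = coeff p k" by simp
  also have "\<dots> = (\<Sum>i\<in>I. if e i = k then c i else 0)"
    by (simp add: p_def coeff_sum)
  also have "\<dots> = (\<Sum>i\<in>{i\<in>I. e i = k}. c i)"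
    using \<open>finite I\<close> by (simp add: sum.If_cases Int_def)
  finally show ?thesis by simp
qed

text \<open>Induction on the variables, isolating one of them by the univariate case while the
  others stay fixed. Each variable has its own set \<open>T v\<close> of values, so that later
  certain coincidences between values can be avoided.\<close>

lemma monomial_sum_coeffs_zero:
  fixes c :: "'i \<Rightarrow> 'k::idom"
  assumes "finite V" "finite I" "\<And>v. infinite (T v)"
    and "\<And>a. (\<And>v. a v \<in> T v) \<Longrightarrow> (\<Sum>i\<in>I. c i * (\<Prod>v\<in>V. a v ^ e i v)) = 0"
  shows "(\<Sum>i\<in>{i\<in>I. \<forall>v\<in>V. e i v = m v}. c i) = 0"
  using assms(1,2,4)
proof (induction V arbitrary: I rule: finite_induct)
  case empty
  have "T v \<noteq> {}" for v using assms(3)[of v] by auto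
  \<comment> \<open>Any point of the grid will do: without variables every monomial is 1, but the
    hypothesis still has to be applied to some point.\<close>
  then have "(\<lambda>v. SOME t. t \<in> T v) v \<in> T v" for v by (simp add: some_in_eq)
  from empty(2)[OF this] show ?case by simp
next
  case (insert v V)
  let ?I = "{i\<in>I. e i v = m v}"
  have "(\<Sum>i\<in>{i\<in>?I. \<forall>v\<in>V. e i v = m v}. c i) = 0"
  proof (rule insert.IH)
    fix a assume a: "\<And>v. a v \<in> T v"
    show "(\<Sum>i\<in>?I. c i * (\<Prod>v\<in>V. a v ^ e i v)) = 0"
    proof (rule power_sum_coeffs_zero[OF insert.prems(1) assms(3)[of v]])
      fix t assume t: "t \<in> T v"
      have "(\<Prod>u\<in>V. (a(v := t)) u ^ e i u) = (\<Prod>u\<in>V. a u ^ e i u)" for i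
        using insert.hyps by (intro prod.cong) auto
      then show "(\<Sum>i\<in>I. c i * (\<Prod>v\<in>V. a v ^ e i v) * t ^ e i v) = 0"
        using insert.prems(2)[of "a(v := t)"] a t insert.hyps by (simp add: mult_ac)
    qed
  qed (use insert.prems in auto)
  then show ?case by (simp add: conj_assoc)
qed


section \<open>Evaluation in the free algebra\<close>

text \<open>Constants and variables generate the free algebra. In this form, properties compatible
  with the algebra operations are proved without mentioning words.\<close>

lemma free_algebra_induct [case_names const var add mult]:
  fixes f :: "('v, 'k::comm_ring_1) free_algebra"
  assumes const: "\<And>c. P (Poly_Mapping.single 0 c)"
    and var: "\<And>v. P (Poly_Mapping.single (mon_of [v]) 1)"
    and add: "\<And>f g. P f \<Longrightarrow> P g \<Longrightarrow> P (f + g)"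
    and mult: "\<And>f g. P f \<Longrightarrow> P g \<Longrightarrow> P (f * g)"
  shows "P f"
proof -
  have word: "P (Poly_Mapping.single (mon_of l) 1)" for l :: "'v list"
  proof (induction l)
    case Nil
    then show ?case using const[of 1] by (simp add: zero_mon_def)
  next
    case (Cons v l)
    have "mon_of (v # l) = mon_of [v] + mon_of l"
      by (metis append_Cons append_Nil mon_of_inverse[OF UNIV_I] plus_mon.rep_eq letters_inverse)
    then have "Poly_Mapping.single (mon_of (v # l)) 1 =
        Poly_Mapping.single (mon_of [v]) (1::'k) * Poly_Mapping.single (mon_of l) 1"
      by (simp add: mult_single)
    then show ?case using mult var Cons by simp
  qed
  have "P (Poly_Mapping.single w c)" for w c
    using mult[OF const[of c] word[of "letters w"]] by (simp add: mult_single letters_inverse)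
  then show ?thesis
    using const[of 0] add by (induction f rule: poly_mapping_single_induct) auto
qed

context assoc_algebra
begin

lemma eval_poly_const: "eval_poly smul \<sigma> (Poly_Mapping.single 0 c) = smul c 1"
  by (simp add: eval_poly_single zero_mon.rep_eq)

lemma eval_poly_var: "eval_poly smul \<sigma> (Poly_Mapping.single (mon_of [v]) 1) = \<sigma> v"
  by (simp add: eval_poly_single mon_of_inverse)

lemma smul_one_mult: "smul c 1 * x = smul c x"
  by (simp flip: smul_mult_left)

end

section \<open>Homomorphisms, and evaluation at central elements\<close>

definition algebra_hom ::
    "('k \<Rightarrow> 'a::ring_1 \<Rightarrow> 'a) \<Rightarrow> ('k \<Rightarrow> 'b::ring_1 \<Rightarrow> 'b) \<Rightarrow> ('a \<Rightarrow> 'b) \<Rightarrow> bool" where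
  "algebra_hom s t h \<longleftrightarrow> h 1 = 1 \<and> (\<forall>x y. h (x + y) = h x + h y \<and> h (x * y) = h x * h y) \<and>
     (\<forall>c x. h (s c x) = t c (h x))"

lemma algebra_hom_zero: "algebra_hom s t h \<Longrightarrow> h 0 = 0"
  unfolding algebra_hom_def by (metis add_cancel_right_right)

text \<open>Both sides respect sums and products in \<open>f\<close> and agree on constants and
  variables.\<close>

lemma algebra_hom_eval_poly:
  assumes "assoc_algebra s" "assoc_algebra t" "algebra_hom s t h"
  shows "h (eval_poly s \<sigma> f) = eval_poly t (h \<circ> \<sigma>) f"
proof -
  interpret s: assoc_algebra s by fact
  interpret t: assoc_algebra t by fact
  show ?thesis
    by (induction f rule: free_algebra_induct)
      (use assms(3) in \<open>simp_all add: algebra_hom_def s.eval_poly_const t.eval_poly_const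
        s.eval_poly_var t.eval_poly_var s.eval_poly_add t.eval_poly_add
        s.eval_poly_mult t.eval_poly_mult\<close>)
qed

text \<open>The first letter of \<open>xs\<close> occurs somewhere in \<open>ys\<close>, and
  centrality moves it to the front there.\<close>

lemma prod_list_central_cong:
  fixes \<sigma> :: "'v \<Rightarrow> 'a::monoid_mult"
  assumes "\<And>v x. \<sigma> v * x = x * \<sigma> v" "mset xs = mset ys"
  shows "prod_list (map \<sigma> xs) = prod_list (map \<sigma> ys)"
  using assms(2)
proof (induction xs arbitrary: ys)
  case (Cons v xs)
  then have "v \<in> set ys" by (metis list.set_intros(1) set_mset_mset)
  then obtain ys1 ys2 where ys: "ys = ys1 @ v # ys2" by (metis split_list)
  then have "prod_list (map \<sigma> xs) = prod_list (map \<sigma> (ys1 @ ys2))"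
    using Cons by (intro Cons.IH) simp
  then have "prod_list (map \<sigma> (v # xs)) = \<sigma> v * prod_list (map \<sigma> ys1) * prod_list (map \<sigma> ys2)"
    by (simp add: mult.assoc)
  then show ?case by (simp add: ys assms(1) mult.assoc)
qed simp

lemma prod_list_eq_prod_count:
  fixes \<sigma> :: "'v \<Rightarrow> 'a::comm_monoid_mult"
  assumes "finite V" "set l \<subseteq> V"
  shows "prod_list (map \<sigma> l) = (\<Prod>v\<in>V. \<sigma> v ^ count (mset l) v)"
  using assms(2)
proof (induction l)
  case (Cons u l)
  have "(\<Prod>v\<in>V. \<sigma> v ^ count (mset (u # l)) v) =
      (\<Prod>v\<in>V. (if v = u then \<sigma> u else 1) * \<sigma> v ^ count (mset l) v)"
    by (rule prod.cong) auto
  with Cons assms(1) show ?case by (simp add: prod.distrib)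
qed simp

text \<open>Central values see of a word only the multiset of its letters. As \<open>'k\<close> is
  infinite, vanishing on \<open>'k\<close> forces the coefficients of all words with a given
  multiset to add up to zero, and then every central evaluation vanishes too.\<close>

lemma eval_poly_central_eq_zero:
  fixes g :: "('v, 'k::field_char_0) free_algebra" and smul :: "'k \<Rightarrow> 'a::ring_1 \<Rightarrow> 'a"
  assumes "assoc_algebra smul" and zero: "\<And>\<sigma>. eval_poly (*) \<sigma> g = 0"
    and central: "\<And>v x. \<tau> v * x = x * \<tau> v"
  shows "eval_poly smul \<tau> g = 0"
proof -
  interpret assoc_algebra smul by fact
  let ?I = "Poly_Mapping.keys g" and ?c = "Poly_Mapping.lookup g"
  let ?m = "\<lambda>w. mset (letters w)"
  define V where "V = (\<Union>w\<in>?I. set (letters w))"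
  have V: "finite V" "\<And>w. w \<in> ?I \<Longrightarrow> set (letters w) \<subseteq> V" by (auto simp: V_def)
  have coeffs: "(\<Sum>w\<in>{w\<in>?I. ?m w = ?m u}. ?c w) = 0" if u: "u \<in> ?I" for u
  proof -
    have "(\<Sum>w\<in>{w\<in>?I. \<forall>v\<in>V. count (?m w) v = count (?m u) v}. ?c w) = 0"
    proof (rule monomial_sum_coeffs_zero[where T="\<lambda>_. UNIV"])
      fix a :: "'v \<Rightarrow> 'k"
      show "(\<Sum>w\<in>?I. ?c w * (\<Prod>v\<in>V. a v ^ count (?m w) v)) = 0"
        using zero[of a] V by (simp add: eval_poly_def prod_list_eq_prod_count cong: sum.cong)
    qed (auto simp: V infinite_UNIV_char_0)
    \<comment> \<open>Both words have all their letters in \<open>V\<close>, so comparing counts on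
      \<open>V\<close> compares the multisets.\<close>
    moreover have "(\<forall>v\<in>V. count (?m w) v = count (?m u) v) \<longleftrightarrow> ?m w = ?m u"
      if "w \<in> ?I" for w
      using V(2)[OF that] V(2)[OF u] by (auto simp: multiset_eq_iff) (metis count_mset_0_iff subsetD)
    ultimately show ?thesis by (simp cong: conj_cong)
  qed
  have "eval_poly smul \<tau> g =
      (\<Sum>m\<in>?m ` ?I. \<Sum>w\<in>{w\<in>?I. ?m w = m}. smul (?c w) (prod_list (map \<tau> (letters w))))"
    unfolding eval_poly_def by (rule sum.image_gen) simp
  also have "\<dots> = 0"
  proof (rule sum.neutral, safe)
    fix u assume u: "u \<in> ?I"
    have "(\<Sum>w\<in>{w\<in>?I. ?m w = ?m u}. smul (?c w) (prod_list (map \<tau> (letters w)))) =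
        (\<Sum>w\<in>{w\<in>?I. ?m w = ?m u}. smul (?c w) (prod_list (map \<tau> (letters u))))"
      by (intro sum.cong refl arg_cong[where f="smul _"] prod_list_central_cong central) auto
    then show "(\<Sum>w\<in>{w\<in>?I. ?m w = ?m u}. smul (?c w) (prod_list (map \<tau> (letters w)))) = 0"
      by (simp add: coeffs[OF u] flip: scale_sum_left)
  qed
  finally show ?thesis .
qed


section \<open>Matrices\<close>

lift_definition sq_map :: "('a \<Rightarrow> 'b) \<Rightarrow> ('a, 'n::finite) sqmat \<Rightarrow> ('b, 'n) sqmat"
  is "\<lambda>h M. \<chi> i j. h (M $ i $ j)" .

lemma algebra_hom_sq_map:
  assumes "algebra_hom s t h"
  shows "algebra_hom (sqmat_scale s) (sqmat_scale t)
    (sq_map h :: ('a::ring_1, 'n::finite) sqmat \<Rightarrow> ('b::ring_1, 'n) sqmat)"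
proof -
  have sum: "h (\<Sum>i\<in>(UNIV::'n set). x i) = (\<Sum>i\<in>UNIV. h (x i))" for x
  proof -
    have "h (sum x A) = (\<Sum>i\<in>A. h (x i))" if "finite A" for A
      using that by induction (use assms in \<open>auto simp: algebra_hom_zero algebra_hom_def\<close>)
    then show ?thesis by simp
  qed
  show ?thesis
    using assms algebra_hom_zero[OF assms]
    unfolding algebra_hom_def entries_inject[symmetric]
    by (simp add: sq_map.rep_eq one_sqmat.rep_eq plus_sqmat.rep_eq times_sqmat.rep_eq
        sqmat_scale.rep_eq vec_eq_iff mat_def matrix_matrix_mult_def sum)
qed

definition mat2 :: "'a::zero \<Rightarrow> 'a \<Rightarrow> 'a \<Rightarrow> 'a \<Rightarrow> ('a, 2) sqmat" where
  "mat2 a b c d = sqmat_of (vector [vector [a, b], vector [c, d]])"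

lemma entries_mat2:
  "entries (mat2 a b c d) $ 1 $ 1 = a" "entries (mat2 a b c d) $ 1 $ 2 = b"
  "entries (mat2 a b c d) $ 2 $ 1 = c" "entries (mat2 a b c d) $ 2 $ 2 = d"
  by (simp_all add: mat2_def sqmat_of_inverse)

lemma mat2_eq_iff:
  fixes a :: "'a::zero"
  shows "M = mat2 a b c d \<longleftrightarrow> entries M $ 1 $ 1 = a \<and> entries M $ 1 $ 2 = b \<and>
    entries M $ 2 $ 1 = c \<and> entries M $ 2 $ 2 = d"
  by (auto simp: entries_inject[symmetric] vec_eq_iff forall_2 entries_mat2)

lemma mat2_simps:
  "mat2 a b c d + mat2 a' b' c' d' = mat2 (a + a') (b + b') (c + c') (d + (d'::'a::ring_1))"
  "mat2 a b c d * mat2 a' b' c' d' =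
     mat2 (a * a' + b * c') (a * b' + b * d') (c * a' + d * c') (c * b' + d * d')"
  "mat2 1 0 0 1 = 1" "mat2 0 0 0 0 = 0"
  "sqmat_scale s x (mat2 a b c d) = mat2 (s x a) (s x b) (s x c) (s x d)"
  "sq_map h (mat2 a b c d) = mat2 (h a) (h b) (h c) (h d)"
  unfolding entries_inject[symmetric] vec_eq_iff forall_2
  by (simp_all add: plus_sqmat.rep_eq times_sqmat.rep_eq one_sqmat.rep_eq
      zero_sqmat.rep_eq sqmat_scale.rep_eq sq_map.rep_eq entries_mat2 mat_def
      matrix_matrix_mult_def sum_2)


text \<open>Coordinates on \<open>A1\<close>, available over any coefficients: besides
  \<open>'k\<close> also the free algebra and Grassmann algebras occur as entries.\<close>

definition ut :: "'a::zero \<Rightarrow> 'a \<Rightarrow> 'a \<Rightarrow> 'a \<Rightarrow> 'a \<Rightarrow> ('a, 3) sqmat" where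
  "ut a b c d e = sqmat_of (vector [vector [a, b, c], vector [0, d, e], vector [0, 0, a]])"

lemma entries_ut:
  "entries (ut a b c d e) $ 1 $ 1 = a" "entries (ut a b c d e) $ 1 $ 2 = b"
  "entries (ut a b c d e) $ 1 $ 3 = c" "entries (ut a b c d e) $ 2 $ 1 = 0"
  "entries (ut a b c d e) $ 2 $ 2 = d" "entries (ut a b c d e) $ 2 $ 3 = e"
  "entries (ut a b c d e) $ 3 $ 1 = 0" "entries (ut a b c d e) $ 3 $ 2 = 0"
  "entries (ut a b c d e) $ 3 $ 3 = a"
  by (simp_all add: ut_def sqmat_of_inverse)

lemma ut_eq_iff:
  "M = ut a b c d e \<longleftrightarrow> entries M $ 1 $ 1 = a \<and> entries M $ 1 $ 2 = b \<and> entries M $ 1 $ 3 = c \<and>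
    entries M $ 2 $ 1 = 0 \<and> entries M $ 2 $ 2 = d \<and> entries M $ 2 $ 3 = e \<and>
    entries M $ 3 $ 1 = 0 \<and> entries M $ 3 $ 2 = 0 \<and> entries M $ 3 $ 3 = a"
  by (auto simp: entries_inject[symmetric] vec_eq_iff forall_3 entries_ut)

lemma ut_simps:
  "ut a b c d e + ut a' b' c' d' e' = ut (a + a') (b + b') (c + c') (d + d') (e + (e'::'a::ring_1))"
  "ut a b c d e * ut a' b' c' d' e' =
     ut (a * a') (a * b' + b * d') (a * c' + b * e' + c * a') (d * d') (d * e' + e * (a'::'a))"
  "ut 1 0 0 1 0 = (1 :: ('a, 3) sqmat)"
  "s x 0 = 0 \<Longrightarrow> sqmat_scale s x (ut a b c d e) = ut (s x a) (s x b) (s x c) (s x d) (s x e)"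
  "h 0 = (0::'b::zero) \<Longrightarrow> sq_map h (ut a b c d e) = ut (h a) (h b) (h c) (h d) (h e)"
  "ut 0 0 0 0 0 = (0 :: ('a, 3) sqmat)"
  unfolding entries_inject[symmetric] vec_eq_iff forall_3
  by (simp_all add: plus_sqmat.rep_eq times_sqmat.rep_eq one_sqmat.rep_eq zero_sqmat.rep_eq
      sqmat_scale.rep_eq sq_map.rep_eq entries_ut mat_def matrix_matrix_mult_def sum_3)

lemma ut_in_A1: "ut a b c d e \<in> A1"
  by (simp add: A1_def UT3_def entries_ut)

lemma A1_cases:
  assumes "M \<in> A1"
  obtains a b c d e where "M = ut a b c d e"
  using assms that[of "entries M $ 1 $ 1" "entries M $ 1 $ 2" "entries M $ 1 $ 3"
      "entries M $ 2 $ 2" "entries M $ 2 $ 3"]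
  by (auto simp: ut_eq_iff A1_def UT3_def)


section \<open>Extension of scalars\<close>

definition centre :: "'a::ring_1 set" where
  "centre = {a. \<forall>x. a * x = x * a}"

lemma centre_closed:
  "0 \<in> centre" "1 \<in> centre" "a \<in> centre \<Longrightarrow> b \<in> centre \<Longrightarrow> a + b \<in> centre"
  "a \<in> centre \<Longrightarrow> b \<in> centre \<Longrightarrow> a - b \<in> centre"
  "a \<in> centre \<Longrightarrow> b \<in> centre \<Longrightarrow> a * b \<in> centre"
proof -
  assume "a \<in> centre" "b \<in> centre"
  then have "a * b * x = x * (a * b)" for x
    unfolding centre_def mem_Collect_eq by (metis mult.assoc)
  then show "a * b \<in> centre" by (simp add: centre_def)
qed (simp_all add: centre_def distrib_left distrib_right left_diff_distrib right_diff_distrib)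

lemma (in assoc_algebra) smul_in_centre: "a \<in> centre \<Longrightarrow> smul c a \<in> centre"
  by (auto simp: centre_def simp flip: smul_mult_left smul_mult_right)

lemma assoc_algebra_free_algebra:
  "assoc_algebra (\<lambda>c (g :: ('v, 'k::comm_ring_1) free_algebra). Poly_Mapping.single 0 c * g)"
proof
  fix c :: 'k and f g :: "('v, 'k) free_algebra"
  have "Poly_Mapping.single 0 c * f = f * Poly_Mapping.single 0 c"
    by (induction f rule: poly_mapping_single_induct)
      (simp_all add: distrib_left distrib_right mult_single mult.commute)
  then show "Poly_Mapping.single 0 c * (f * g) = f * (Poly_Mapping.single 0 c * g)"
    by (metis mult.assoc)
qed (simp_all add: algebra_simps single_add mult_single flip: mult.assoc)

text \<open>The entries of \<open>f\<close> at generic matrices are polynomials in the entry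
  variables. They vanish under all substitutions from \<open>'k\<close>, hence under all central
  ones.\<close>

lemma A1_identity_central:
  fixes f :: "(nat, 'k::field_char_0) free_algebra" and smul :: "'k \<Rightarrow> 'a::ring_1 \<Rightarrow> 'a"
  assumes smul: "assoc_algebra smul"
    and f: "f \<in> T_ideal (sqmat_scale (*)) (A1 :: ('k, 3) sqmat set)"
    and N: "\<And>i. \<exists>a\<in>centre. \<exists>b\<in>centre. \<exists>c\<in>centre. \<exists>d\<in>centre. \<exists>e\<in>centre. N i = ut a b c d e"
  shows "eval_poly (sqmat_scale smul) N f = 0"
proof -
  interpret assoc_algebra smul by fact
  let ?s = "\<lambda>c (g :: (nat \<times> nat, 'k) free_algebra). Poly_Mapping.single 0 c * g"
  let ?X = "\<lambda>i k. Poly_Mapping.single (mon_of [(i, k)]) 1 :: (nat \<times> nat, 'k) free_algebra"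
  \<comment> \<open>generic matrices: identities of \<open>A1\<close> become polynomial identities between their entries\<close>
  define G where "G i = ut (?X i 0) (?X i 1) (?X i 2) (?X i 3) (?X i 4)" for i
  define H where "H = eval_poly (sqmat_scale ?s) G f"
  \<comment> \<open>Substituting into \<open>H\<close> is the same as evaluating \<open>f\<close> at
    the substituted matrices. This is used twice, once over \<open>'k\<close> and once over
    \<open>'a\<close>.\<close>
  have H: "sq_map (eval_poly t \<sigma>) H = eval_poly (sqmat_scale t)
      (\<lambda>i. ut (\<sigma> (i, 0)) (\<sigma> (i, 1)) (\<sigma> (i, 2)) (\<sigma> (i, 3)) (\<sigma> (i, 4))) f"
    if "assoc_algebra t" for t :: "'k \<Rightarrow> 'b::ring_1 \<Rightarrow> 'b" and \<sigma> :: "nat \<times> nat \<Rightarrow> 'b"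
  proof -
    interpret t: assoc_algebra t by fact
    have "algebra_hom ?s t (eval_poly t \<sigma>)"
      by (simp add: algebra_hom_def t.eval_poly_one t.eval_poly_add t.eval_poly_mult
          t.eval_poly_const t.smul_one_mult)
    note hom = algebra_hom_sq_map[where 'n=3, OF this]
    show ?thesis
      unfolding H_def algebra_hom_eval_poly[OF assoc_algebra_sqmat[OF assoc_algebra_free_algebra]
          assoc_algebra_sqmat[OF that] hom]
      by (simp add: G_def comp_def ut_simps(5) t.eval_poly_zero t.eval_poly_var)
  qed
  obtain a b c d e where N: "\<And>i. N i = ut (a i) (b i) (c i) (d i) (e i)"
    and central: "\<And>i. a i \<in> centre" "\<And>i. b i \<in> centre" "\<And>i. c i \<in> centre"
      "\<And>i. d i \<in> centre" "\<And>i. e i \<in> centre"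
    using N by metis
  \<comment> \<open>Only the indices 0 to 4 occur in \<open>G\<close>; the last branch also covers
    larger \<open>k\<close>, which keeps every value of \<open>\<tau>\<close> central.\<close>
  define \<tau> where "\<tau> = (\<lambda>(i, k::nat). if k = 0 then a i else if k = 1 then b i
    else if k = 2 then c i else if k = 3 then d i else e i)"
  have "eval_poly smul \<tau> (entries H $ i $ j) = 0" for i j
  proof (rule eval_poly_central_eq_zero[OF smul])
    fix \<sigma> :: "nat \<times> nat \<Rightarrow> 'k"
    have "sq_map (eval_poly (*) \<sigma>) H = 0"
      unfolding H[OF assoc_algebra_base] using f ut_in_A1 by (fastforce simp: T_ideal_def)
    from arg_cong[OF this, of "\<lambda>M. entries M $ i $ j"]
    show "eval_poly (*) \<sigma> (entries H $ i $ j) = 0"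
      by (simp add: sq_map.rep_eq zero_sqmat.rep_eq)
  next
    fix v x show "\<tau> v * x = x * \<tau> v"
      using central by (auto simp: \<tau>_def centre_def split: prod.splits)
  qed
  then have "sq_map (eval_poly smul \<tau>) H = 0"
    by (simp add: entries_inject[symmetric] vec_eq_iff sq_map.rep_eq zero_sqmat.rep_eq)
  then show ?thesis
    unfolding H[OF smul] by (simp add: \<tau>_def N[abs_def])
qed


section \<open>Two odd parameters\<close>

locale odd_pair =
  fixes \<eta> \<theta> :: "'a::ring_1"
  assumes \<eta>_square: "\<eta> * \<eta> = 0" and \<theta>_square: "\<theta> * \<theta> = 0" and anticommute: "\<theta> * \<eta> = - (\<eta> * \<theta>)"
begin

text \<open>\<open>N\<close> and \<open>N'\<close> record the closed walks at the first and at the second vertex: a walk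
  \<open>1 \<rightarrow> 2 \<rightarrow> 1\<close> of \<open>M\<close> becomes the walk \<open>1 \<rightarrow> 2 \<rightarrow> 3\<close> of \<open>N\<close>, and longer alternating walks vanish
  because \<open>\<eta>\<close> or \<open>\<theta>\<close> occurs twice.\<close>

definition rel :: "('a, 2) sqmat \<Rightarrow> ('a, 3) sqmat \<Rightarrow> ('a, 3) sqmat \<Rightarrow> bool" where
  "rel M N N' \<longleftrightarrow> (\<exists>a b c d e g. {a, b, c, d, e, g} \<subseteq> centre \<and>
     N = ut a b c d e \<and> N' = ut d e g a b \<and>
     M = mat2 (a + c * (\<eta> * \<theta>)) (b * \<eta>) (e * \<theta>) (d + g * (\<theta> * \<eta>)))"

lemma relE:
  assumes "rel M N N'"
  obtains a b c d e g where "{a, b, c, d, e, g} \<subseteq> centre" "N = ut a b c d e" "N' = ut d e g a b"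
    "M = mat2 (a + c * (\<eta> * \<theta>)) (b * \<eta>) (e * \<theta>) (d + g * (\<theta> * \<eta>))"
  using assms unfolding rel_def by blast

lemma relI:
  "{a, b, c, d, e, g} \<subseteq> centre \<Longrightarrow>
    rel (mat2 (a + c * (\<eta> * \<theta>)) (b * \<eta>) (e * \<theta>) (d + g * (\<theta> * \<eta>))) (ut a b c d e) (ut d e g a b)"
  unfolding rel_def by blast

lemma rel_add:
  assumes "rel M N N'" "rel M1 N1 N1'"
  shows "rel (M + M1) (N + N1) (N' + N1')"
proof -
  obtain a b c d e g a' b' c' d' e' g'
    where cen: "{a, b, c, d, e, g} \<subseteq> centre" "{a', b', c', d', e', g'} \<subseteq> centre"
    and eq: "N = ut a b c d e" "N' = ut d e g a b"
      "M = mat2 (a + c * (\<eta> * \<theta>)) (b * \<eta>) (e * \<theta>) (d + g * (\<theta> * \<eta>))"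
      "N1 = ut a' b' c' d' e'" "N1' = ut d' e' g' a' b'"
      "M1 = mat2 (a' + c' * (\<eta> * \<theta>)) (b' * \<eta>) (e' * \<theta>) (d' + g' * (\<theta> * \<eta>))"
    using assms unfolding rel_def by blast
  have "{a + a', b + b', c + c', d + d', e + e', g + g'} \<subseteq> centre"
    using cen by (simp add: centre_closed)
  from relI[OF this] show ?thesis
    unfolding eq ut_simps mat2_simps by (simp add: algebra_simps)
qed

text \<open>Since \<eta>\<theta>\<eta> = \<theta>\<eta>\<theta> = 0, the coefficient of
  \<eta>\<theta> in the first diagonal entry of the product is
  \<open>a * c' + b * e' + c * a'\<close>, which is the (1,3) entry of \<open>N * N1\<close>. The
  other diagonal entry is symmetric, with \<open>N'\<close> in place of \<open>N\<close>.\<close>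

lemma rel_mult:
  assumes "rel M N N'" "rel M1 N1 N1'"
  shows "rel (M * M1) (N * N1) (N' * N1')"
proof -
  obtain a b c d e g a' b' c' d' e' g'
    where cen: "{a, b, c, d, e, g} \<subseteq> centre" "{a', b', c', d', e', g'} \<subseteq> centre"
    and eq: "N = ut a b c d e" "N' = ut d e g a b"
      "M = mat2 (a + c * (\<eta> * \<theta>)) (b * \<eta>) (e * \<theta>) (d + g * (\<theta> * \<eta>))"
      "N1 = ut a' b' c' d' e'" "N1' = ut d' e' g' a' b'"
      "M1 = mat2 (a' + c' * (\<eta> * \<theta>)) (b' * \<eta>) (e' * \<theta>) (d' + g' * (\<theta> * \<eta>))"
    using assms unfolding rel_def by blast
  have squares: "\<eta> * (\<eta> * x) = 0" "\<theta> * (\<theta> * x) = 0" for x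
    by (simp_all add: \<eta>_square \<theta>_square flip: mult.assoc)
  have \<theta>\<eta>: "\<theta> * (\<eta> * x) = - (\<eta> * (\<theta> * x))" for x
    by (metis anticommute minus_mult_left mult.assoc)
  \<comment> \<open>Below, \<open>y\<close> is restricted to \<open>\<eta>\<close> and
    \<open>\<theta>\<close>, so that rewriting moves central coefficients to the left of the odd
    elements.\<close>
  have "y * z = z * y" "y * (z * x) = z * (y * x)" if "z \<in> {a', b', c', d', e', g'}" for y z x
    using that cen(2) by (auto simp: centre_def simp flip: mult.assoc)
  then have move: "\<forall>y\<in>{\<eta>, \<theta>}. \<forall>z\<in>{a', b', c', d', e', g'}.
      y * z = z * y \<and> (\<forall>x. y * (z * x) = z * (y * x))"
    by blast
  note move = move[simplified]
  have "{a * a', a * b' + b * d', a * c' + b * e' + c * a', d * d', d * e' + e * a',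
      d * g' + e * b' + g * d'} \<subseteq> centre"
    using cen by (simp add: centre_closed)
  from relI[OF this] show ?thesis
    unfolding eq ut_simps mat2_simps
    by (simp add: algebra_simps move squares \<theta>\<eta> anticommute
        \<eta>_square \<theta>_square)
qed

lemma rel_one: "rel 1 1 1"
  using relI[of 1 0 0 1 0 0] by (simp add: centre_closed ut_simps mat2_simps)

lemma rel_smul:
  assumes "assoc_algebra smul" "rel M N N'"
  shows "rel (sqmat_scale smul x M) (sqmat_scale smul x N) (sqmat_scale smul x N')"
proof -
  interpret assoc_algebra smul by fact
  obtain a b c d e g where cen: "{a, b, c, d, e, g} \<subseteq> centre"
    and eq: "N = ut a b c d e" "N' = ut d e g a b"
      "M = mat2 (a + c * (\<eta> * \<theta>)) (b * \<eta>) (e * \<theta>) (d + g * (\<theta> * \<eta>))"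
    using assms(2) unfolding rel_def by blast
  have "{smul x a, smul x b, smul x c, smul x d, smul x e, smul x g} \<subseteq> centre"
    using cen by (simp add: smul_in_centre)
  from relI[OF this] show ?thesis
    unfolding eq by (simp add: ut_simps mat2_simps scale_right_distrib flip: smul_mult_left)
qed

text \<open>By the preceding lemmas \<open>rel\<close> is a subalgebra of the product of three
  matrix algebras, hence stable under evaluation.\<close>

lemma rel_eval_poly:
  fixes smul :: "'k::comm_ring_1 \<Rightarrow> 'a \<Rightarrow> 'a"
  assumes smul: "assoc_algebra smul" and rel: "\<And>i. rel (M i) (N i) (N' i)"
  shows "rel (eval_poly (sqmat_scale smul) M f) (eval_poly (sqmat_scale smul) N f)
    (eval_poly (sqmat_scale smul) N' f)"
proof -
  interpret m2: assoc_algebra "sqmat_scale smul :: 'k \<Rightarrow> ('a, 2) sqmat \<Rightarrow> _"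
    by (rule assoc_algebra_sqmat) fact
  interpret m3: assoc_algebra "sqmat_scale smul :: 'k \<Rightarrow> ('a, 3) sqmat \<Rightarrow> _"
    by (rule assoc_algebra_sqmat) fact
  show ?thesis
    by (induction f rule: free_algebra_induct)
      (simp_all add: m2.eval_poly_const m3.eval_poly_const m2.eval_poly_var m3.eval_poly_var
        m2.eval_poly_add m3.eval_poly_add m2.eval_poly_mult m3.eval_poly_mult
        rel_add rel_mult rel_smul[OF smul rel_one] rel)
qed

text \<open>The first zero kills all parameters except \<open>g\<close>, which is visible only in
  the second matrix.\<close>

lemma rel_zeroD: "rel M 0 0 \<Longrightarrow> M = 0"
  unfolding rel_def by (auto simp: ut_eq_iff zero_sqmat.rep_eq mat2_simps)

lemma rel_central:
  assumes "rel M N N'"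
  shows "\<exists>a\<in>centre. \<exists>b\<in>centre. \<exists>c\<in>centre. \<exists>d\<in>centre. \<exists>e\<in>centre. N = ut a b c d e"
    and "\<exists>a\<in>centre. \<exists>b\<in>centre. \<exists>c\<in>centre. \<exists>d\<in>centre. \<exists>e\<in>centre. N' = ut a b c d e"
  using assms unfolding rel_def by blast+

end


section \<open>Odd elements of a Grassmann algebra\<close>

text \<open>The parity automorphism: 1 on the even part and -1 on the odd part.\<close>

lift_definition gr_involution :: "('i, 'r::comm_ring_1) grassmann \<Rightarrow> ('i, 'r) grassmann"
  is "\<lambda>f S. (- 1) ^ card S * f S" .

lemma gr_involution_add: "gr_involution (x + y) = gr_involution x + gr_involution y"
  by transfer (simp add: algebra_simps)

lemma gr_involution_involution: "gr_involution (gr_involution x) = x"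
  by transfer (simp flip: mult.assoc power_add mult_2)

lemma gr_involution_scalar_mult:
  fixes x :: "('i::{finite,linorder}, 'r::comm_ring_1) grassmann"
  shows "gr_involution (gr_scalar r * x) = gr_scalar r * gr_involution x"
proof -
  have "gr_coeff (gr_involution (gr_scalar r * x)) S = gr_coeff (gr_scalar r * gr_involution x) S" for S
    by (simp add: gr_involution.rep_eq gr_scalar_mult)
  then show ?thesis by (simp add: gr_coeff_inject[symmetric] fun_eq_iff)
qed

text \<open>Moving a generator past a product of n generators costs the sign (-1)^n. At
  \<open>S\<close> each side has at most one term, coming from the splitting of \<open>S\<close>
  into \<open>{i}\<close> and \<open>S - {i}\<close>.\<close>

lemma gr_gen_mult:
  fixes x :: "('i::{finite,linorder}, 'r::comm_ring_1) grassmann"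
  shows "gr_gen i * x = gr_involution x * gr_gen i"
proof -
  have "gr_coeff (gr_gen i * x) S = gr_coeff (gr_involution x * gr_gen i) S" for S
  proof -
    have l: "gr_coeff (gr_gen i * x) S =
        (\<Sum>A\<in>Pow S. if A = {i} then shuffle_sign {i} (S - {i}) * gr_coeff x (S - {i}) else 0)"
      unfolding times_grassmann.rep_eq gr_gen.rep_eq by (rule sum.cong) auto
    have r: "gr_coeff (gr_involution x * gr_gen i) S = (\<Sum>A\<in>Pow S. if A = S - {i} then if i \<in> S
        then shuffle_sign (S - {i}) {i} * gr_coeff (gr_involution x) (S - {i}) else 0 else 0)"
      unfolding times_grassmann.rep_eq gr_gen.rep_eq
    proof (rule sum.cong)
      fix A assume "A \<in> Pow S"
      then have "S - A = {i} \<longleftrightarrow> i \<in> S \<and> A = S - {i}" by auto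
      then show "shuffle_sign A (S - A) * gr_coeff (gr_involution x) A *
          (if S - A = {i} then 1 else 0) = (if A = S - {i} then if i \<in> S
          then shuffle_sign (S - {i}) {i} * gr_coeff (gr_involution x) (S - {i}) else 0 else 0)"
        by (auto simp: double_diff)
    qed simp
    show ?thesis
    proof (cases "i \<in> S")
      case True
      let ?L = "{b\<in>S. b < i}" and ?G = "{b\<in>S. i < b}"
      \<comment> \<open>With \<open>i\<close> in front the inversions are the elements of
        \<open>S\<close> below \<open>i\<close>, with \<open>i\<close> at the end those above
        \<open>i\<close>. Together these make up \<open>S - {i}\<close>.\<close>
      have "{(a, b). a \<in> {i} \<and> b \<in> S - {i} \<and> b < a} = Pair i ` ?L"
        "{(a, b). a \<in> S - {i} \<and> b \<in> {i} \<and> b < a} = (\<lambda>a. (a, i)) ` ?G" by auto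
      then have sign: "shuffle_sign {i} (S - {i}) = (- 1 :: 'r) ^ card ?L"
        "shuffle_sign (S - {i}) {i} = (- 1 :: 'r) ^ card ?G"
        by (simp_all add: shuffle_sign_def card_image inj_on_def)
      have "card (S - {i}) = card (?L \<union> ?G)" by (rule arg_cong[where f=card]) auto
      also have "\<dots> = card ?L + card ?G" by (rule card_Un_disjoint) auto
      finally have "card (S - {i}) = card ?L + card ?G" .
      then have "(- 1 :: 'r) ^ card ?L = (- 1) ^ card ?G * (- 1) ^ card (S - {i})"
        by (simp add: minus_one_power_iff)
      then show ?thesis
        unfolding l r using True by (simp add: sum.delta sign gr_involution.rep_eq mult.assoc)
    next
      case False
      then show ?thesis unfolding l r by (simp add: sum.delta)
    qed
  qed
  then show ?thesis by (simp add: gr_coeff_inject[symmetric] fun_eq_iff)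
qed

lemma gr_scalar_in_centre: "gr_scalar r \<in> (centre :: ('i::{finite,linorder}, 'r::comm_ring_1) grassmann set)"
  by (simp add: centre_def gr_scalar_central)

text \<open>Oddness is expressed by the commutation behaviour that the computations need, which
  avoids expanding into basis products.\<close>

definition gr_odd :: "('i::{finite,linorder}, 'r::comm_ring_1) grassmann set" where
  "gr_odd = {x. (\<forall>b. x * b = gr_involution b * x) \<and> gr_involution x = - x}"

lemma gr_oddI:
  "(\<And>b. x * b = gr_involution b * x) \<Longrightarrow> gr_involution x = - x \<Longrightarrow> x \<in> gr_odd"
  by (simp add: gr_odd_def)

lemma gr_oddD:
  assumes "x \<in> gr_odd"
  shows "x * b = gr_involution b * x" "gr_involution x = - x"
  using assms unfolding gr_odd_def by blast+

lemma gr_gen_odd: "(gr_gen i :: ('i::{finite,linorder}, 'r::comm_ring_1) grassmann) \<in> gr_odd"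
proof (rule gr_oddI)
  show "gr_involution (gr_gen i) = (- gr_gen i :: ('i, 'r) grassmann)"
    by transfer (auto simp: fun_eq_iff)
qed (rule gr_gen_mult)

lemma gr_odd_add:
  assumes "x \<in> gr_odd" "y \<in> gr_odd"
  shows "x + y \<in> gr_odd"
proof (rule gr_oddI)
  show "(x + y) * b = gr_involution b * (x + y)" for b
    unfolding distrib_left distrib_right gr_oddD(1)[OF assms(1), of b] gr_oddD(1)[OF assms(2), of b] ..
qed (simp add: gr_involution_add assms gr_oddD(2))

lemma gr_odd_scalar:
  assumes "x \<in> gr_odd"
  shows "gr_scalar r * x \<in> gr_odd"
proof (rule gr_oddI)
  fix b
  have "gr_scalar r * x * b = (gr_scalar r * gr_involution b) * x"
    unfolding mult.assoc gr_oddD(1)[OF assms, of b] ..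
  also have "\<dots> = gr_involution b * (gr_scalar r * x)"
    unfolding gr_scalar_central mult.assoc ..
  finally show "gr_scalar r * x * b = gr_involution b * (gr_scalar r * x)" .
qed (simp add: gr_involution_scalar_mult gr_oddD(2)[OF assms])

lemma gr_odd_anticommute: "x \<in> gr_odd \<Longrightarrow> y \<in> gr_odd \<Longrightarrow> x * y = - (y * x)"
  using gr_oddD(1)[of x y] gr_oddD(2)[of y] by simp

text \<open>An odd element anticommutes with itself, so twice its square is zero, and 2 cancels in
  the coefficients.\<close>

lemma gr_odd_square:
  fixes x :: "('i::{finite,linorder}, 'r::field_char_0) grassmann"
  assumes "x \<in> gr_odd"
  shows "x * x = 0"
proof -
  have "gr_coeff (x * x) S = - gr_coeff (x * x) S" for S
    using gr_odd_anticommute[OF assms assms] by (metis uminus_grassmann.rep_eq)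
  then have "2 * gr_coeff (x * x) S = 0" for S
    by (metis add.right_inverse mult_2)
  then show ?thesis by (simp add: gr_coeff_inject[symmetric] fun_eq_iff zero_grassmann.rep_eq)
qed

text \<open>Passing two odd elements applies the parity involution twice.\<close>

lemma gr_odd_mult_in_centre:
  assumes "x \<in> gr_odd" "y \<in> gr_odd"
  shows "x * y \<in> centre"
proof -
  have "x * y * b = b * (x * y)" for b
  proof -
    have "x * y * b = x * gr_involution b * y"
      unfolding mult.assoc gr_oddD(1)[OF assms(2), of b] ..
    also have "x * gr_involution b = b * x"
      by (simp add: gr_oddD(1)[OF assms(1)] gr_involution_involution)
    finally show ?thesis by (simp add: mult.assoc)
  qed
  then show ?thesis by (simp add: centre_def)
qed

lemma odd_pair_gr_odd:
  fixes x :: "('i::{finite,linorder}, 'r::field_char_0) grassmann"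
  shows "x \<in> gr_odd \<Longrightarrow> y \<in> gr_odd \<Longrightarrow> odd_pair x y"
  unfolding odd_pair_def by (simp add: gr_odd_square gr_odd_anticommute[of y x])

section \<open>Conjugation by matrices with odd off-diagonal entries\<close>

lemma arg_cong4:
  "a = a' \<Longrightarrow> b = b' \<Longrightarrow> c = c' \<Longrightarrow> d = d' \<Longrightarrow> f a b c d = f a' b' c' d'"
  by simp

text \<open>The outer factors are inverse to each other by \<open>mat2_unipotent_inverse\<close>. Up
  to central factors the off-diagonal entries become \<open>y - (x - x') * p\<close> and
  \<open>y' + (x - x') * q\<close>, which can be made zero when \<open>x - x'\<close> is
  invertible.\<close>

lemma conjugate_mat2:
  fixes p q x x' y y' :: "('i::{finite,linorder}, 'r::field_char_0) grassmann"
  assumes odd: "p \<in> gr_odd" "q \<in> gr_odd" "y \<in> gr_odd" "y' \<in> gr_odd"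
    and central: "x \<in> centre" "x' \<in> centre"
  shows "mat2 1 p q 1 * mat2 x y y' x' * mat2 (1 + p * q) (- p) (- q) (1 + q * p) =
    mat2 ((x + p * y') * (1 + p * q) - y * q - x' * (p * q)) ((1 + q * p) * (y - (x - x') * p))
      ((1 + p * q) * (y' + (x - x') * q)) ((x' + q * y) * (1 + q * p) - y' * p - x * (q * p))"
proof -
  note sq = odd[THEN gr_odd_square]
  have sq': "\<forall>u\<in>{p, q, y, y'}. \<forall>w. u * (u * w) = 0"
    using sq by (auto simp flip: mult.assoc)
  note sq' = sq'[simplified]
  \<comment> \<open>The rules sort products: first \<open>x\<close> and \<open>x'\<close>, then
    \<open>p\<close>, then \<open>q\<close>, and \<open>y\<close> or \<open>y'\<close> last. The
    second form of each rule acts inside a longer product.\<close>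
  have qp: "q * p = - (p * q)" "q * (p * w) = - (p * (q * w))" for w
    using gr_odd_anticommute[OF odd(2,1)] by (auto simp flip: mult.assoc)
  have yp: "y * p = - (p * y)" "y * (p * w) = - (p * (y * w))" for w
    using gr_odd_anticommute[OF odd(3,1)] by (auto simp flip: mult.assoc)
  have y'p: "y' * p = - (p * y')" "y' * (p * w) = - (p * (y' * w))" for w
    using gr_odd_anticommute[OF odd(4,1)] by (auto simp flip: mult.assoc)
  have yq: "y * q = - (q * y)" "y * (q * w) = - (q * (y * w))" for w
    using gr_odd_anticommute[OF odd(3,2)] by (auto simp flip: mult.assoc)
  have y'q: "y' * q = - (q * y')" "y' * (q * w) = - (q * (y' * w))" for w
    using gr_odd_anticommute[OF odd(4,2)] by (auto simp flip: mult.assoc)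
  have "u * z = z * u" "u * (z * w) = z * (u * w)" if "z \<in> {x, x'}" for u z w
    using that central by (auto simp: centre_def simp flip: mult.assoc)
  then have move: "\<forall>u\<in>{p, q, y, y'}. \<forall>z\<in>{x, x'}. u * z = z * u \<and> (\<forall>w. u * (z * w) = z * (u * w))"
    by blast
  note move = move[simplified]
  show ?thesis
    unfolding mat2_simps
    by (rule arg_cong4[where f=mat2])
      (simp_all add: algebra_simps sq sq' move qp yp y'p yq y'q)
qed

text \<open>All error terms are \<open>p * (q * p)\<close> or \<open>q * (p * q)\<close>, in which
  an odd element occurs twice.\<close>

lemma mat2_unipotent_inverse:
  fixes p q :: "('i::{finite,linorder}, 'r::field_char_0) grassmann"
  assumes odd: "p \<in> gr_odd" "q \<in> gr_odd"
  shows "mat2 1 p q 1 * mat2 (1 + p * q) (- p) (- q) (1 + q * p) = 1"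
    and "mat2 (1 + p * q) (- p) (- q) (1 + q * p) * mat2 1 p q 1 = 1"
proof -
  have sq: "p * p = 0" "q * q = 0" using odd by (simp_all add: gr_odd_square)
  have qp: "q * p = - (p * q)" using gr_odd_anticommute[OF odd(2,1)] .
  have "p * (q * p) = - ((p * p) * q)" by (simp add: qp mult.assoc)
  moreover have "q * (p * q) = - (p * (q * q))" by (simp add: qp flip: mult.assoc)
  ultimately have pqp: "p * (q * p) = 0" "q * (p * q) = 0" by (simp_all add: sq)
  show "mat2 1 p q 1 * mat2 (1 + p * q) (- p) (- q) (1 + q * p) = 1"
    "mat2 (1 + p * q) (- p) (- q) (1 + q * p) * mat2 1 p q 1 = 1"
    unfolding mat2_simps(2) mat2_simps(3)[symmetric]
    by (rule arg_cong4[where f=mat2]; simp add: distrib_left distrib_right mult.assoc pqp sq)+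
qed


section \<open>Specialising the even variables\<close>

definition poly_eval :: "('v::finite \<Rightarrow> 'k::comm_ring_1) \<Rightarrow> (('v \<Rightarrow>\<^sub>0 nat) \<Rightarrow>\<^sub>0 'k) \<Rightarrow> 'k" where
  "poly_eval a p = (\<Sum>m\<in>Poly_Mapping.keys p. Poly_Mapping.lookup p m *
    (\<Prod>v\<in>UNIV. a v ^ Poly_Mapping.lookup m v))"

lemma poly_eval_superset:
  assumes "finite S" "Poly_Mapping.keys p \<subseteq> S"
  shows "poly_eval a p = (\<Sum>m\<in>S. Poly_Mapping.lookup p m *
    (\<Prod>v\<in>UNIV. a v ^ Poly_Mapping.lookup m v))"
  unfolding poly_eval_def
  by (rule sum.mono_neutral_left) (use assms in \<open>auto simp: in_keys_iff\<close>)

lemma poly_eval_single: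
  "poly_eval a (Poly_Mapping.single m c) = c * (\<Prod>v\<in>UNIV. a v ^ Poly_Mapping.lookup m v)"
  by (subst poly_eval_superset[where S="{m}"]) auto

lemma poly_eval_zero: "poly_eval a 0 = 0"
  by (simp add: poly_eval_def)

lemma poly_eval_one: "poly_eval a 1 = 1"
  using poly_eval_single[of a 0 1] by simp

lemma poly_eval_add: "poly_eval a (p + q) = poly_eval a p + poly_eval a q"
proof -
  let ?S = "Poly_Mapping.keys p \<union> Poly_Mapping.keys q"
  have "Poly_Mapping.keys (p + q) \<subseteq> ?S" by (rule keys_add)
  then show ?thesis
    by (simp add: poly_eval_superset[where S="?S"] lookup_add distrib_right sum.distrib)
qed

lemma poly_eval_mult: "poly_eval a (p * q) = poly_eval a p * poly_eval a q"
proof -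
  have single: "poly_eval a (Poly_Mapping.single m c * q) = poly_eval a (Poly_Mapping.single m c) * poly_eval a q"
    for m c
    by (induction q rule: poly_mapping_single_induct)
      (simp_all add: mult_single poly_eval_single poly_eval_zero poly_eval_add distrib_left
        lookup_add power_add prod.distrib mult_ac)
  show ?thesis
    by (induction p rule: poly_mapping_single_induct)
      (simp_all add: single poly_eval_zero poly_eval_add distrib_right)
qed

lemma poly_eval_sum: "poly_eval a (\<Sum>i\<in>A. p i) = (\<Sum>i\<in>A. poly_eval a (p i))"
  by (induction A rule: infinite_finite_induct) (simp_all add: poly_eval_zero poly_eval_add)

lemma poly_eval_uminus: "poly_eval a (- p) = - poly_eval a p"
  by (metis add.right_inverse add_eq_0_iff poly_eval_add poly_eval_zero)

lemma poly_eval_shuffle_sign: "poly_eval a (shuffle_sign A B) = shuffle_sign A B"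
proof -
  have "poly_eval a ((- 1) ^ n) = (- 1) ^ n" for n
    by (induction n) (simp_all add: poly_eval_one poly_eval_mult poly_eval_uminus)
  then show ?thesis by (simp add: shuffle_sign_def)
qed

text \<open>Distinct monomials have distinct exponent vectors, so each sum in
  \<open>monomial_sum_coeffs_zero\<close> is a single coefficient.\<close>

lemma poly_eval_eq_zeroD:
  fixes p :: "('v::finite \<Rightarrow>\<^sub>0 nat) \<Rightarrow>\<^sub>0 'k::field"
  assumes "\<And>v. infinite (T v)" and "\<And>a. (\<And>v. a v \<in> T v) \<Longrightarrow> poly_eval a p = 0"
  shows "p = 0"
proof (rule poly_mapping_eqI)
  fix u
  have "(\<Sum>m\<in>{m\<in>Poly_Mapping.keys p. \<forall>v\<in>UNIV. Poly_Mapping.lookup m v = Poly_Mapping.lookup u v}.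
      Poly_Mapping.lookup p m) = 0"
    using assms by (intro monomial_sum_coeffs_zero[where T=T]) (auto simp: poly_eval_def)
  moreover have "(\<forall>v. Poly_Mapping.lookup m v = Poly_Mapping.lookup u v) \<longleftrightarrow> m = u" for m
    by (simp add: poly_mapping_eq_iff fun_eq_iff)
  ultimately have "(\<Sum>m\<in>{m\<in>Poly_Mapping.keys p. m = u}. Poly_Mapping.lookup p m) = 0" by simp
  also have "{m\<in>Poly_Mapping.keys p. m = u} = (if u \<in> Poly_Mapping.keys p then {u} else {})"
    by auto
  finally show "Poly_Mapping.lookup p u = Poly_Mapping.lookup 0 u"
    by (auto simp: in_keys_iff split: if_splits)
qed

section \<open>From supercommutative polynomials to the Grassmann algebra over the field\<close>

definition gr_smul :: "'r::comm_ring_1 \<Rightarrow> ('i::{finite,linorder}, 'r) grassmann \<Rightarrow> ('i, 'r) grassmann" where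
  "gr_smul c x = gr_scalar c * x"

lemma gr_scalar_hom:
  "gr_scalar (c + d) = gr_scalar c + (gr_scalar d :: ('i::{finite,linorder}, 'r::comm_ring_1) grassmann)"
  "gr_scalar (c - d) = gr_scalar c - (gr_scalar d :: ('i, 'r) grassmann)"
  "gr_scalar (- d) = - (gr_scalar d :: ('i, 'r) grassmann)"
  "gr_scalar (c * d) = gr_scalar c * (gr_scalar d :: ('i, 'r) grassmann)"
  "gr_scalar 0 = (0 :: ('i, 'r) grassmann)"
  "gr_scalar 1 = (1 :: ('i, 'r) grassmann)"
  by (simp_all add: gr_coeff_inject[symmetric] fun_eq_iff gr_scalar_mult gr_scalar.rep_eq
      plus_grassmann.rep_eq minus_grassmann.rep_eq uminus_grassmann.rep_eq zero_grassmann.rep_eq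
      one_grassmann.rep_eq)

lemma assoc_algebra_gr_smul: "assoc_algebra gr_smul"
proof
  fix c :: "'r::comm_ring_1" and x y :: "('i::{finite,linorder}, 'r) grassmann"
  show "gr_smul c (x * y) = x * gr_smul c y"
    unfolding gr_smul_def by (metis gr_scalar_central mult.assoc)
qed (simp_all add: gr_smul_def gr_scalar_hom distrib_left distrib_right mult.assoc)

lemma algebra_hom_gr_scalar: "algebra_hom (*) gr_smul gr_scalar"
  by (simp add: algebra_hom_def gr_smul_def gr_scalar_hom)

text \<open>The homomorphism from K[X;Y] to E(Y) that sends each even variable \<open>v\<close> to
  \<open>a v\<close>, fixes the odd variables in \<open>U\<close> and kills the other odd
  ones.\<close>

definition specialise ::
    "(gvar \<Rightarrow> 'k::comm_ring_1) \<Rightarrow> gvar set \<Rightarrow> 'k supercomm \<Rightarrow> (gvar, 'k) grassmann" where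
  "specialise a U x = Grassmann (\<lambda>S. if S \<subseteq> U then poly_eval a (gr_coeff x S) else 0)"

lemma gr_coeff_specialise:
  "gr_coeff (specialise a U x) S = (if S \<subseteq> U then poly_eval a (gr_coeff x S) else 0)"
  by (simp add: specialise_def Grassmann_inverse)

text \<open>For products: if \<open>S\<close> lies in \<open>U\<close>, so do both parts of every
  splitting of \<open>S\<close>; otherwise one part does not, and its factor is killed.\<close>

lemma algebra_hom_specialise: "algebra_hom sc_scale gr_smul (specialise a U)"
proof -
  have "gr_coeff (specialise a U (x * y)) S = gr_coeff (specialise a U x * specialise a U y) S" for x y S
  proof (cases "S \<subseteq> U")
    case True
    then have "A \<subseteq> U \<and> S - A \<subseteq> U" if "A \<in> Pow S" for A using that by blast
    with True show ?thesis
      unfolding gr_coeff_specialise times_grassmann.rep_eq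
      by (auto simp: poly_eval_sum poly_eval_mult poly_eval_shuffle_sign intro!: sum.cong)
  next
    case False
    then have "\<not> A \<subseteq> U \<or> \<not> S - A \<subseteq> U" for A by blast
    then have "(\<Sum>A\<in>Pow S. shuffle_sign A (S - A) * gr_coeff (specialise a U x) A *
        gr_coeff (specialise a U y) (S - A)) = 0"
      by (intro sum.neutral) (auto simp: gr_coeff_specialise)
    then show ?thesis using False by (simp add: times_grassmann.rep_eq gr_coeff_specialise)
  qed
  then have "specialise a U (x * y) = specialise a U x * specialise a U y" for x y
    by (simp add: gr_coeff_inject[symmetric] fun_eq_iff)
  moreover have "specialise a U (x + y) = specialise a U x + specialise a U y" for x y
    by (simp add: gr_coeff_inject[symmetric] fun_eq_iff gr_coeff_specialise plus_grassmann.rep_eq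
        poly_eval_add)
  moreover have "specialise a U 1 = 1"
    by (auto simp: gr_coeff_inject[symmetric] fun_eq_iff gr_coeff_specialise one_grassmann.rep_eq
        poly_eval_zero poly_eval_one)
  moreover have "specialise a U (sc_scale c x) = gr_smul c (specialise a U x)" for c x
    by (simp add: gr_coeff_inject[symmetric] fun_eq_iff gr_coeff_specialise sc_scale_def gr_smul_def
        gr_scalar_mult poly_eval_mult poly_eval_single)
  ultimately show ?thesis by (simp add: algebra_hom_def)
qed

lemma specialise_even_var: "specialise a U (even_var v) = gr_scalar (a v)"
proof -
  have "(\<Prod>w\<in>UNIV. a w ^ Poly_Mapping.lookup (Poly_Mapping.single v (1::nat)) w) =
      (\<Prod>w\<in>UNIV. if w = v then a v else 1)"
    by (rule prod.cong) (auto simp: lookup_single)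
  then have "poly_eval a (Poly_Mapping.single (Poly_Mapping.single v 1) 1) = a v"
    by (simp add: poly_eval_single)
  then show ?thesis
    by (auto simp: gr_coeff_inject[symmetric] fun_eq_iff gr_coeff_specialise even_var_def
        gr_scalar.rep_eq poly_eval_zero)
qed

lemma specialise_odd_var: "specialise a U (odd_var v) = (if v \<in> U then gr_gen v else 0)"
  by (auto simp: gr_coeff_inject[symmetric] fun_eq_iff gr_coeff_specialise odd_var_def
      gr_gen.rep_eq poly_eval_zero poly_eval_one zero_grassmann.rep_eq)

lemma specialise_eq_zeroD:
  fixes x :: "'k::field supercomm"
  assumes "\<And>v. infinite (T v)" and "\<And>a. (\<And>v. a v \<in> T v) \<Longrightarrow> specialise a UNIV x = 0"
  shows "x = 0"
proof -
  have "gr_coeff x S = 0" for S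
  proof (rule poly_eval_eq_zeroD[OF assms(1)])
    fix a assume "\<And>v. a v \<in> T v"
    from arg_cong[OF assms(2)[OF this], of "\<lambda>y. gr_coeff y S"]
    show "poly_eval a (gr_coeff x S) = 0"
      by (simp add: gr_coeff_specialise zero_grassmann.rep_eq)
  qed
  then show ?thesis by (simp add: gr_coeff_inject[symmetric] fun_eq_iff zero_grassmann.rep_eq)
qed

lemma generic_matrix_mat2:
  "generic_matrix v v' = mat2 (even_var v) (odd_var v) (odd_var v') (even_var v')"
  by (simp add: mat2_eq_iff generic_matrix_entries)


section \<open>Both inclusions\<close>

lemma is_subalgebra_F: "is_subalgebra (sqmat_scale sc_scale) F"
  unfolding F_def by (rule is_subalgebra_generated)

lemma C1_in_F: "C1 \<in> F" and C2_in_F: "C2 \<in> F"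
  unfolding F_def generated_subalgebra_def by (auto intro: hull_inc)

text \<open>The matrices whose conjugated specialisation satisfies \<open>rel\<close> form a
  subalgebra, so only \<open>C1\<close> and \<open>C2\<close> need checking. The condition on
  \<open>a\<close> makes the image of x_1 - x_1' an invertible scalar, and one \<open>P\<close>
  serves for all of \<open>F\<close>.\<close>

lemma F_rel:
  fixes a :: "gvar \<Rightarrow> 'k::field_char_0"
  assumes "a V1 \<noteq> a V1'"
  obtains P P' :: "((gvar, 'k) grassmann, 2) sqmat" and \<eta> \<theta>
  where "P * P' = 1" "P' * P = 1" "odd_pair \<eta> \<theta>"
    "\<And>M. M \<in> F \<Longrightarrow> \<exists>N N'. odd_pair.rel \<eta> \<theta> (P * sq_map (specialise a UNIV) M * P') N N'"
proof -
  define z where "z = a V1 - a V1'"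
  have "z \<noteq> 0" using assms by (simp add: z_def)
  \<comment> \<open>chosen such that the off-diagonal entries of the conjugate of \<open>C1\<close> vanish\<close>
  define p q :: "(gvar, 'k) grassmann"
    where "p = gr_scalar (1 / z) * gr_gen V1" and "q = gr_scalar (- 1 / z) * gr_gen V1'"
  \<comment> \<open>The off-diagonal entries of the conjugate of \<open>C2\<close>, up to the
    central factors \<open>1 + q * p\<close> and \<open>1 + p * q\<close>.\<close>
  define \<eta> \<theta> :: "(gvar, 'k) grassmann"
    where "\<eta> = gr_gen V2 - (gr_scalar (a V2) - gr_scalar (a V2')) * p"
      and "\<theta> = gr_gen V2' + (gr_scalar (a V2) - gr_scalar (a V2')) * q"
  define P P' where "P = mat2 1 p q 1" and "P' = mat2 (1 + p * q) (- p) (- q) (1 + q * p)"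
  have p: "p \<in> gr_odd" and q: "q \<in> gr_odd"
    by (simp_all add: p_def q_def gr_odd_scalar gr_gen_odd)
  have "\<eta> = gr_gen V2 + gr_scalar (a V2' - a V2) * p"
    by (simp add: \<eta>_def gr_scalar_hom algebra_simps)
  then have \<eta>: "\<eta> \<in> gr_odd" using p by (simp add: gr_odd_add gr_odd_scalar gr_gen_odd)
  have "\<theta> = gr_gen V2' + gr_scalar (a V2 - a V2') * q"
    by (simp add: \<theta>_def gr_scalar_hom)
  then have \<theta>: "\<theta> \<in> gr_odd" using q by (simp add: gr_odd_add gr_odd_scalar gr_gen_odd)
  interpret odd_pair \<eta> \<theta> using \<eta> \<theta> by (rule odd_pair_gr_odd)
  have P: "P * P' = 1" "P' * P = 1"
    unfolding P_def P'_def using p q by (rule mat2_unipotent_inverse)+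
  let ?h = "sq_map (specialise a UNIV) :: ('k supercomm, 2) sqmat \<Rightarrow> _"
  note cen = gr_odd_mult_in_centre[OF p q] gr_odd_mult_in_centre[OF q p] gr_scalar_in_centre
  have generic: "P * ?h (generic_matrix v v') * P' = mat2
      ((gr_scalar (a v) + p * gr_gen v') * (1 + p * q) - gr_gen v * q - gr_scalar (a v') * (p * q))
      ((1 + q * p) * (gr_gen v - (gr_scalar (a v) - gr_scalar (a v')) * p))
      ((1 + p * q) * (gr_gen v' + (gr_scalar (a v) - gr_scalar (a v')) * q))
      ((gr_scalar (a v') + q * gr_gen v) * (1 + q * p) - gr_gen v' * p - gr_scalar (a v) * (q * p))"
    for v v'
    using conjugate_mat2[OF p q gr_gen_odd gr_gen_odd gr_scalar_in_centre gr_scalar_in_centre]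
    by (simp add: generic_matrix_mat2 mat2_simps(6) specialise_even_var specialise_odd_var P_def P'_def)
  have diagonal: "(gr_scalar (a v) + p * gr_gen v') * (1 + p * q) - gr_gen v * q - gr_scalar (a v') * (p * q)
      \<in> centre"
    "(gr_scalar (a v') + q * gr_gen v) * (1 + q * p) - gr_gen v' * p - gr_scalar (a v) * (q * p)
      \<in> centre" for v v'
    by (simp_all add: centre_closed cen gr_odd_mult_in_centre p q gr_gen_odd)
  have rel_generic: "\<exists>N N'. rel (P * ?h (generic_matrix v v') * P') N N'"
    if "gr_gen v - (gr_scalar (a v) - gr_scalar (a v')) * p = gr_scalar r * \<eta>"
      "gr_gen v' + (gr_scalar (a v) - gr_scalar (a v')) * q = gr_scalar r * \<theta>" for v v' r
  proof -
    \<comment> \<open>The diagonal entries are not scalars but central, so they serve whole as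
      \<open>a\<close> and \<open>d\<close> of \<open>rel\<close>, with
      \<open>c = g = 0\<close>.\<close>
    have "{(gr_scalar (a v) + p * gr_gen v') * (1 + p * q) - gr_gen v * q - gr_scalar (a v') * (p * q),
      (1 + q * p) * gr_scalar r, 0,
      (gr_scalar (a v') + q * gr_gen v) * (1 + q * p) - gr_gen v' * p - gr_scalar (a v) * (q * p),
      (1 + p * q) * gr_scalar r, 0} \<subseteq> centre"
      using diagonal(1)[of v v'] diagonal(2)[of v' v] by (simp add: centre_closed cen)
    from relI[OF this] show ?thesis
      unfolding generic that mult.assoc[symmetric] by auto
  qed
  have "gr_scalar z * p = gr_gen V1" "gr_scalar z * q = - gr_gen V1'"
    using \<open>z \<noteq> 0\<close> by (simp_all add: p_def q_def gr_scalar_hom flip: mult.assoc gr_scalar_hom(4))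
  \<comment> \<open>The factor \<open>r\<close> is 0 for the diagonalised \<open>C1\<close>, and 1
    for \<open>C2\<close> by the choice of \<open>\<eta>\<close> and
    \<open>\<theta>\<close>.\<close>
  then have "\<exists>N N'. rel (P * ?h C1 * P') N N'"
    unfolding C1_def by (intro rel_generic[of _ _ 0]) (simp_all add: gr_scalar_hom z_def)
  moreover have "\<exists>N N'. rel (P * ?h C2 * P') N N'"
    unfolding C2_def by (intro rel_generic[of _ _ 1]) (simp_all add: gr_scalar_hom \<eta>_def \<theta>_def)
  moreover define B where "B = {M. \<exists>N N'. rel (P * ?h M * P') N N'}"
  moreover have "is_subalgebra (sqmat_scale sc_scale) B"
  proof -
    interpret m2: assoc_algebra "sqmat_scale gr_smul :: 'k \<Rightarrow> ((gvar, 'k) grassmann, 2) sqmat \<Rightarrow> _"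
      by (intro assoc_algebra_sqmat assoc_algebra_gr_smul)
    have h: "?h 1 = 1" "?h (x + y) = ?h x + ?h y" "?h (x * y) = ?h x * ?h y"
      "?h (sqmat_scale sc_scale c x) = sqmat_scale gr_smul c (?h x)" for x y c
      using algebra_hom_sq_map[where 'n=2, OF algebra_hom_specialise, of a UNIV] by (simp_all add: algebra_hom_def)
    have "P * ?h (x * y) * P' = (P * ?h x * P') * (P * ?h y * P')" for x y
    proof -
      have "(P * ?h x * P') * (P * ?h y * P') = P * ?h x * (P' * P) * ?h y * P'"
        by (simp only: mult.assoc)
      then show ?thesis by (simp add: h P mult.assoc)
    qed
    moreover have "P * ?h (x + y) * P' = P * ?h x * P' + P * ?h y * P'" for x y
      by (simp add: h distrib_left distrib_right)
    moreover have "P * ?h (sqmat_scale sc_scale c x) * P' = sqmat_scale gr_smul c (P * ?h x * P')" for x c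
      by (simp add: h m2.smul_mult_left m2.smul_mult_right)
        (metis m2.smul_mult_left m2.smul_mult_right)
    moreover have "P * ?h 1 * P' = 1" by (simp add: h P)
    ultimately show ?thesis
      unfolding is_subalgebra_def B_def
      by (auto simp only: mem_Collect_eq
          intro: rel_one rel_add rel_mult rel_smul[OF assoc_algebra_gr_smul])
  qed
  ultimately have "F \<subseteq> B"
    unfolding F_def generated_subalgebra_def by (intro hull_minimal) auto
  show thesis
    by (rule that[OF P odd_pair_axioms]) (use \<open>F \<subseteq> B\<close> in \<open>auto simp: B_def\<close>)
qed

text \<open>Instead of inverting x_1 - x_1', the even variables are specialised to scalars that keep
  x_1 and x_1' apart. Enough such specialisations exist to detect every nonzero element of
  K[X;Y].\<close>

lemma T_ideal_A1_subset_T_ideal_F: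
  "T_ideal (sqmat_scale (*)) (A1 :: ('k::field_char_0, 3) sqmat set) \<subseteq>
    T_ideal (sqmat_scale sc_scale) (F :: ('k supercomm, 2) sqmat set)"
proof
  fix f assume f: "f \<in> T_ideal (sqmat_scale (*)) (A1 :: ('k, 3) sqmat set)"
  have "eval_poly (sqmat_scale sc_scale) \<sigma> f = 0"
    if "range \<sigma> \<subseteq> (F :: ('k supercomm, 2) sqmat set)" for \<sigma>
  proof -
    let ?e = "eval_poly (sqmat_scale sc_scale) \<sigma> f"
    have vanish: "sq_map (specialise a UNIV) ?e = 0" if a: "a V1 \<noteq> a V1'" for a :: "gvar \<Rightarrow> 'k"
    proof -
      let ?h = "sq_map (specialise a UNIV) :: ('k supercomm, 2) sqmat \<Rightarrow> _"
      obtain P P' \<eta> \<theta> where P: "P * P' = 1" "P' * P = 1" and "odd_pair \<eta> \<theta>"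
        and rel: "\<And>M. M \<in> F \<Longrightarrow> \<exists>N N'. odd_pair.rel \<eta> \<theta> (P * ?h M * P') N N'"
        using F_rel[OF a] by metis
      interpret odd_pair \<eta> \<theta> by fact
      interpret m2: assoc_algebra "sqmat_scale gr_smul :: 'k \<Rightarrow> ((gvar, 'k) grassmann, 2) sqmat \<Rightarrow> _"
        by (intro assoc_algebra_sqmat assoc_algebra_gr_smul)
      have "\<forall>i. \<exists>N N'. rel (P * ?h (\<sigma> i) * P') N N'"
        using rel \<open>range \<sigma> \<subseteq> F\<close> by blast
      then obtain N N' where N: "\<And>i. rel (P * ?h (\<sigma> i) * P') (N i) (N' i)"
        by metis
      \<comment> \<open>Both companions have the shape of \<open>A1\<close> with central entries, so
        the identity \<open>f\<close> holds for each of them.\<close>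
      have "eval_poly (sqmat_scale gr_smul) N f = 0" "eval_poly (sqmat_scale gr_smul) N' f = 0"
        using A1_identity_central[OF assoc_algebra_gr_smul f] rel_central[OF N] by metis+
      then have zero: "eval_poly (sqmat_scale gr_smul) (\<lambda>i. P * ?h (\<sigma> i) * P') f = 0"
        using rel_eval_poly[where N=N and N'=N' and f=f, OF assoc_algebra_gr_smul N] rel_zeroD by metis
      have conj: "algebra_hom (sqmat_scale gr_smul) (sqmat_scale gr_smul) (\<lambda>x. P * x * P')"
      proof -
        have "P * (x * y) * P' = (P * x * P') * (P * y * P')" for x y
        proof -
          have "(P * x * P') * (P * y * P') = P * x * (P' * P) * y * P'" by (simp only: mult.assoc)
          then show ?thesis by (simp add: P mult.assoc)
        qed
        moreover have "P * sqmat_scale gr_smul c x * P' = sqmat_scale gr_smul c (P * x * P')" for x c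
          by (metis m2.smul_mult_left m2.smul_mult_right)
        ultimately show ?thesis by (simp add: algebra_hom_def P distrib_left distrib_right)
      qed
      have "P * ?h ?e * P' = 0"
        using algebra_hom_eval_poly[OF m2.assoc_algebra_axioms m2.assoc_algebra_axioms conj, of "?h \<circ> \<sigma>" f]
          algebra_hom_eval_poly[OF assoc_algebra_sqmat[OF assoc_algebra_supercomm] m2.assoc_algebra_axioms
            algebra_hom_sq_map[OF algebra_hom_specialise], of a UNIV \<sigma> f] zero
        by (simp add: comp_def)
      moreover have "P' * (P * ?h ?e * P') * P = (P' * P) * ?h ?e * (P' * P)"
        by (simp only: mult.assoc)
      ultimately show ?thesis by (simp add: P)
    qed
    \<comment> \<open>infinitely many values for each variable, with those of \<open>x\<^sub>1\<close> and \<open>x\<^sub>1'\<close> disjoint\<close>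
    define T :: "gvar \<Rightarrow> 'k set" where
      "T v = (if v = V1 then range (\<lambda>n. of_nat (2 * n)) else range (\<lambda>n. of_nat (2 * n + 1)))" for v
    have infinite: "infinite (T v)" for v
    proof -
      have "inj (of_nat :: nat \<Rightarrow> 'k)" by (rule inj_of_nat)
      moreover have "inj (\<lambda>n::nat. 2 * n)" "inj (\<lambda>n::nat. 2 * n + 1)" by (simp_all add: inj_def)
      ultimately have "inj (\<lambda>n. of_nat (2 * n) :: 'k)" "inj (\<lambda>n. of_nat (2 * n + 1) :: 'k)"
        using inj_compose[unfolded comp_def] by blast+
      then show ?thesis by (simp add: T_def range_inj_infinite)
    qed
    have distinct: "a V1 \<noteq> a V1'" if T: "\<And>v. a v \<in> T v" for a :: "gvar \<Rightarrow> 'k"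
    proof
      assume "a V1 = a V1'"
      moreover obtain m n where "a V1 = of_nat (2 * m)" "a V1' = of_nat (2 * n + 1)"
        using T[of V1] T[of V1'] by (auto simp: T_def)
      ultimately have "2 * m = 2 * n + 1" by (metis of_nat_eq_iff)
      then show False by presburger
    qed
    have "entries ?e $ i $ j = 0" for i j
    proof (rule specialise_eq_zeroD[of T, OF infinite])
      fix a :: "gvar \<Rightarrow> 'k" assume "\<And>v. a v \<in> T v"
      then have "a V1 \<noteq> a V1'" by (rule distinct)
      from arg_cong[OF vanish[OF this], where f="\<lambda>M. entries M $ i $ j"]
      show "specialise a UNIV (entries ?e $ i $ j) = 0"
        by (simp add: sq_map.rep_eq zero_sqmat.rep_eq)
    qed
    then show ?thesis by (simp add: entries_inject[symmetric] vec_eq_iff zero_sqmat.rep_eq)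
  qed
  then show "f \<in> T_ideal (sqmat_scale sc_scale) (F :: ('k supercomm, 2) sqmat set)"
    by (simp add: T_ideal_def)
qed

text \<open>Every matrix over \<open>'k\<close> in \<open>A1\<close> is the first companion, in the
  sense of \<open>rel\<close>, of such an image. Here \<open>C1\<close> becomes the matrix unit at
  (1,1) and \<open>C2\<close> becomes purely off-diagonal.\<close>

lemma F_lift:
  fixes \<alpha> b c \<beta> e :: "'k::field_char_0"
  shows "\<exists>M\<in>F. sq_map (specialise (\<lambda>v. if v = V1 then 1 else 0) {V2, V2'}) M =
    mat2 (gr_scalar \<alpha> + gr_scalar c * (gr_gen V2 * gr_gen V2')) (gr_scalar b * gr_gen V2)
      (gr_scalar e * gr_gen V2') (gr_scalar \<beta>)"
proof -
  let ?s = "sqmat_scale sc_scale :: 'k \<Rightarrow> ('k supercomm, 2) sqmat \<Rightarrow> _"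
  let ?h = "sq_map (specialise (\<lambda>v. if v = V1 then 1 else 0) {V2, V2'}) :: ('k supercomm, 2) sqmat \<Rightarrow> _"
  define D where "D = C1 * C2 + ?s (- 1) (C2 * C1)"
  \<comment> \<open>The commutator \<open>D\<close> has image with off-diagonal entries y_2 and
    -y_2'. Left multiplication by \<open>C1\<close> selects the first row, and
    \<open>C1 * D * D\<close> contributes -y_2 y_2' at (1,1); this explains the signs of
    \<open>e\<close> and \<open>c\<close>.\<close>
  define M where "M = ?s \<beta> 1 + ?s (\<alpha> - \<beta>) C1 + ?s b (C1 * D) + ?s (- e) (D + ?s (- 1) (C1 * D)) +
    ?s (- c) (C1 * D * D)"
  have "D \<in> F"
    using is_subalgebra_F C1_in_F C2_in_F unfolding is_subalgebra_def D_def by blast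
  then have "M \<in> F"
    using is_subalgebra_F C1_in_F unfolding is_subalgebra_def M_def by blast
  have h: "?h 1 = 1" "?h (x + y) = ?h x + ?h y" "?h (x * y) = ?h x * ?h y"
    "?h (?s c x) = sqmat_scale gr_smul c (?h x)" for x y c
    using algebra_hom_sq_map[where 'n=2, OF algebra_hom_specialise,
        of "\<lambda>v. if v = V1 then 1 else 0 :: 'k" "{V2, V2'}"]
    by (simp_all add: algebra_hom_def)
  have C: "?h C1 = mat2 1 0 0 0" "?h C2 = mat2 0 (gr_gen V2) (gr_gen V2') 0"
    by (simp_all add: C1_def C2_def generic_matrix_mat2 mat2_simps(6) specialise_even_var
        specialise_odd_var gr_scalar_hom)
  have D: "?h D = mat2 0 (gr_gen V2) (- gr_gen V2') 0"
    unfolding D_def h C mat2_simps by (simp add: gr_smul_def gr_scalar_hom)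
  have "?h M = mat2 (gr_scalar \<alpha> + gr_scalar c * (gr_gen V2 * gr_gen V2')) (gr_scalar b * gr_gen V2)
      (gr_scalar e * gr_gen V2') (gr_scalar \<beta>)"
    unfolding M_def h C D unfolding mat2_simps(3)[symmetric]
    unfolding mat2_simps(1,2,4-6) by (simp add: gr_smul_def gr_scalar_hom)
  with \<open>M \<in> F\<close> show ?thesis by blast
qed

text \<open>A substitution from \<open>A1\<close> lifts to \<open>F\<close>, where \<open>f\<close>
  vanishes. Thus \<open>rel\<close> links 0 to the value of \<open>f\<close> in \<open>A1\<close>,
  whose entries can be read off because 1, y_2, y_2' and y_2 y_2' are linearly independent over
  \<open>'k\<close>.\<close>

lemma T_ideal_F_subset_T_ideal_A1:
  "T_ideal (sqmat_scale sc_scale) (F :: ('k::field_char_0 supercomm, 2) sqmat set) \<subseteq>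
    T_ideal (sqmat_scale (*)) (A1 :: ('k, 3) sqmat set)"
proof
  fix f assume f: "f \<in> T_ideal (sqmat_scale sc_scale) (F :: ('k supercomm, 2) sqmat set)"
  let ?h = "sq_map (specialise (\<lambda>v. if v = V1 then 1 else 0) {V2, V2'}) :: ('k supercomm, 2) sqmat \<Rightarrow> _"
  let ?y = "gr_gen V2 :: (gvar, 'k) grassmann" and ?y' = "gr_gen V2' :: (gvar, 'k) grassmann"
  let ?sc = "sq_map gr_scalar :: ('k, 3) sqmat \<Rightarrow> ((gvar, 'k) grassmann, 3) sqmat"
  interpret odd_pair ?y ?y' by (intro odd_pair_gr_odd gr_gen_odd)
  have "eval_poly (sqmat_scale (*)) \<sigma> f = 0" if \<sigma>: "range \<sigma> \<subseteq> (A1 :: ('k, 3) sqmat set)" for \<sigma>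
  proof -
    have "\<exists>M\<in>F. \<exists>X'. rel (?h M) (?sc (\<sigma> i)) (?sc X')" for i
    proof -
      obtain \<alpha> b c \<beta> e where i: "\<sigma> i = ut \<alpha> b c \<beta> e"
        using \<sigma> by (metis A1_cases range_subsetD)
      obtain M where "M \<in> F" and M: "?h M = mat2 (gr_scalar \<alpha> + gr_scalar c * (?y * ?y'))
          (gr_scalar b * ?y) (gr_scalar e * ?y') (gr_scalar \<beta>)"
        using F_lift by blast
      have "rel (?h M) (?sc (\<sigma> i)) (?sc (ut \<beta> e 0 \<alpha> b))"
        using relI[of "gr_scalar \<alpha>" "gr_scalar b" "gr_scalar c" "gr_scalar \<beta>" "gr_scalar e" 0]
        by (simp add: M i ut_simps(5) gr_scalar_hom gr_scalar_in_centre centre_closed)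
      then show ?thesis using \<open>M \<in> F\<close> by blast
    qed
    then obtain M X' where M: "\<And>i. M i \<in> F" and rel: "\<And>i. rel (?h (M i)) (?sc (\<sigma> i)) (?sc (X' i))"
      by metis
    let ?e = "eval_poly (sqmat_scale (*)) \<sigma> f" and ?e' = "eval_poly (sqmat_scale (*)) X' f"
    have "eval_poly (sqmat_scale sc_scale) M f = 0"
      using f M by (auto simp: T_ideal_def)
    then have "eval_poly (sqmat_scale gr_smul) (?h \<circ> M) f = 0"
      using algebra_hom_eval_poly[OF assoc_algebra_sqmat[OF assoc_algebra_supercomm]
          assoc_algebra_sqmat[OF assoc_algebra_gr_smul] algebra_hom_sq_map[OF algebra_hom_specialise]]
        algebra_hom_zero[OF algebra_hom_sq_map[OF algebra_hom_specialise]] by metis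
    moreover have "eval_poly (sqmat_scale gr_smul) (?sc \<circ> X) f = ?sc (eval_poly (sqmat_scale (*)) X f)" for X
      using algebra_hom_eval_poly[OF assoc_algebra_sqmat[OF assoc_algebra_base]
          assoc_algebra_sqmat[OF assoc_algebra_gr_smul] algebra_hom_sq_map[OF algebra_hom_gr_scalar]]
      by metis
    moreover have "rel (eval_poly (sqmat_scale gr_smul) (?h \<circ> M) f)
        (eval_poly (sqmat_scale gr_smul) (?sc \<circ> \<sigma>) f) (eval_poly (sqmat_scale gr_smul) (?sc \<circ> X') f)"
      using rel by (intro rel_eval_poly assoc_algebra_gr_smul) simp
    ultimately have "rel 0 (?sc ?e) (?sc ?e')" by simp
    then obtain a b c d e g where "{a, b, c, d, e, g} \<subseteq> centre"
      and e: "?sc ?e = ut a b c d e" and e': "?sc ?e' = ut d e g a b"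
      and zero: "0 = mat2 (a + c * (?y * ?y')) (b * ?y) (e * ?y') (d + g * (?y' * ?y))"
      by (rule relE)
    let ?x = "\<lambda>i j. entries ?e $ i $ j" and ?x' = "\<lambda>i j. entries ?e' $ i $ j"
    \<comment> \<open>It matters that the parameters are scalars: a merely central \<open>b\<close>,
      such as y_2 y_2', can satisfy \<open>b * ?y = 0\<close> without being zero.\<close>
    have abc: "a = gr_scalar (?x 1 1)" "b = gr_scalar (?x 1 2)" "c = gr_scalar (?x 1 3)"
      "d = gr_scalar (?x 2 2)" "e = gr_scalar (?x 2 3)" "g = gr_scalar (?x' 1 3)"
      using e e' by (simp_all add: ut_eq_iff sq_map.rep_eq)
    have inj: "gr_scalar r = (0 :: (gvar, 'k) grassmann) \<Longrightarrow> r = 0" for r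
      by (drule arg_cong[where f="\<lambda>x. gr_coeff x {}"]) (simp add: gr_scalar.rep_eq zero_grassmann.rep_eq)
    have coeffs: "gr_coeff (a + c * (?y * ?y')) S = 0" "gr_coeff (b * ?y) S = 0"
        "gr_coeff (e * ?y') S = 0" "gr_coeff (d + g * (?y' * ?y)) S = 0" for S
    proof -
      have "a + c * (?y * ?y') = 0" "b * ?y = 0" "e * ?y' = 0" "d + g * (?y' * ?y) = 0"
        using zero by (simp_all add: mat2_eq_iff zero_sqmat.rep_eq)
      then show "gr_coeff (a + c * (?y * ?y')) S = 0" "gr_coeff (b * ?y) S = 0"
        "gr_coeff (e * ?y') S = 0" "gr_coeff (d + g * (?y' * ?y)) S = 0"
        by (simp_all only: zero_grassmann.rep_eq)
    qed
    note coeff_simps = abc plus_grassmann.rep_eq gr_scalar_mult gr_scalar.rep_eq gr_gen.rep_eq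
      gr_coeff_gen_mult_gen
    have "?x 1 1 = 0" "?x 2 2 = 0"
      using coeffs(1)[of "{}"] coeffs(4)[of "{}"] by (simp_all add: coeff_simps)
    moreover have "?x 1 3 = 0"
      using coeffs(1)[of "{V2, V2'}"] by (simp add: coeff_simps less_gvar_def)
    moreover have "?x 1 2 = 0" "?x 2 3 = 0"
      using coeffs(2)[of "{V2}"] coeffs(3)[of "{V2'}"] by (simp_all add: coeff_simps)
    moreover have "?x 2 1 = 0" "?x 3 1 = 0" "?x 3 2 = 0"
      using e by (simp_all add: ut_eq_iff sq_map.rep_eq inj)
    moreover have "gr_scalar (?x 3 3 - ?x 1 1) = (0 :: (gvar, 'k) grassmann)"
      using e by (simp add: ut_eq_iff sq_map.rep_eq gr_scalar_hom(2))
    then have "?x 3 3 = ?x 1 1" using inj by force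
    ultimately have "?e = ut 0 0 0 0 0" by (simp add: ut_eq_iff)
    then show ?thesis by (simp add: ut_simps(6))
  qed
  then show "f \<in> T_ideal (sqmat_scale (*)) (A1 :: ('k, 3) sqmat set)"
    by (simp add: T_ideal_def)
qed

theorem corollary9:
  shows "PI_equivalent
    (sqmat_scale sc_scale) (F :: ('k::field_char_0 supercomm, 2) sqmat set)
    (sqmat_scale (*)) (A1 :: ('k, 3) sqmat set)"
  unfolding PI_equivalent_def
  using T_ideal_F_subset_T_ideal_A1 T_ideal_A1_subset_T_ideal_F by (rule equalityI)

end
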